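(* (a) The cyclic descent number $\operatorname{cdes}$ is cyclic shuffle-compatible. (b) The linear map on $\mathcal{A}_{\operatorname{cdes}}^{\mathrm{cyc}}$ defined by $$[\pi]_{\operatorname{cdes}}\mapsto\begin{cases}\displaystyle \frac{\operatorname{cdes}[\pi]\,t^{\operatorname{cdes}[\pi]}+(|\pi|-\operatorname{cdes}[\pi])\,t^{\operatorname{cdes}[\pi]+1}}{(1-t)^{|\pi|+1}}x^{|\pi|}, & \text{if }|\pi|\geq1,\\ 1/(1-t), & \text{if }|\pi|=0,\end{cases}$$ is a $\mathbb{Q}$-algebra isomorphism from $\mathcal{A}_{\operatorname{cdes}}^{\mathrm{cyc}}$ to the span of $$\left\{ \frac{1}{1-t},\frac{tx}{(1-t)^{2}}\right\} \cup\left\{ \frac{kt^{k}+(n-k)t^{k+1}}{(1-t)^{n+1}}x^{n}\right\}_{n\geq2,\ 1\leq k\leq n-1},$$ a subalgebra of $\mathbb{Q}[[t*]][x]$. (c) The linear map on $\mathcal{A}_{\operatorname{cdes}}^{\mathrm{cyc}}$ defined by $$[\pi]_{\operatorname{cdes}}\mapsto\begin{cases}\displaystyle \binom{p+|\pi|-\operatorname{cdes}[\pi]-1}{|\pi|-1}p\,x^{|\pi|}, & \text{if }|\pi|\geq1,\\ 1, & \text{if }|\pi|=0,\end{cases}$$ is a $\mathbb{Q}$-algebra isomorphism from $\mathcal{A}_{\operatorname{cdes}}^{\mathrm{cyc}}$ to the span of $$\{1,px\}\cup\left\{ \binom{p+n-k-1}{n-1}p\,x^{n}\right\}_{n\geq2,\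 1\leq k\leq n-1},$$ a subalgebra of $\mathbb{Q}[x]^{\mathbb{N}}$. (d) For all $n\geq2$, the $n$th homogeneous component of $\mathcal{A}_{\operatorname{cdes}}^{\mathrm{cyc}}$ has dimension $n-1$.
   Context: A (linear) permutation of length $n\ge 0$ is a sequence $\pi=\pi_1\cdots\pi_n$ of $n$ distinct positive integers; $|\pi|=n$; $\mathfrak{P}_n$ is the set of permutations of length $n$. Two permutations are disjoint if they have no letter in common, and have the same relative order if they have the same standardization (replace the $i$th smallest letter by $i$). For disjoint $\pi\in\mathfrak{P}_m$, $\sigma\in\mathfrak{P}_n$, $\operatorname{Sh}(\pi,\sigma)$ is the set of $\tau\in\mathfrak{P}_{m+n}$ having both $\pi$ and $\sigma$ as subsequences. The cyclic permutation $[\pi]$ is the set of all rotations of $\pi$; its length is $|\pi|$. A cyclic permutation statistic is a function $\operatorname{cst}$ on cyclic permutations with $\operatorname{cst}[\pi]=\operatorname{cst}[\sigma]$ whenever $\pi,\sigma$ have the same relative order. For disjoint $\pi,\sigma$, $\operatorname{cSh}([\pi],[\sigma])$ is the set of all $[\tau]$ with $\tau\in\operatorname{Sh}(\bar\pi,\bar\sigma)$ for some $\bar\pi\in[\pi]$, $\bar\sigma\in[\sigma]$. The statistic $\operatorname{cst}$ is cyclic shuffle-compatible if for disjoint $\pi,\sigma$ the multiset $\{\{\operatorname{cst}[\tau]:[\tau]\in\operatorname{cSh}([\pi],[\sigma])\}\}$ depends only on $\operatorname{cst}[\pi],\operatorname{cst}[\sigma],|\pi|,|\sigma|$. $[\pi]_{\operatorname{cst}}$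 denotes the equivalence class of $[\pi]$ under: $[\pi]\sim[\sigma]$ iff $\operatorname{cst}[\pi]=\operatorname{cst}[\sigma]$ and $|\pi|=|\sigma|$. $\mathcal{A}^{\mathrm{cyc}}_{\operatorname{cst}}$ is the $\mathbb{Q}$-vector space with basis these classes; when $\operatorname{cst}$ is cyclic shuffle-compatible it is a $\mathbb{Q}$-algebra with multiplication $[\pi]_{\operatorname{cst}}[\sigma]_{\operatorname{cst}}=\sum_{[\tau]\in\operatorname{cSh}([\pi],[\sigma])}[\tau]_{\operatorname{cst}}$ for $\pi,\sigma$ disjoint. It is graded by length: the $n$th homogeneous component is spanned by the classes of cyclic permutations of length $n$. For $\pi\in\mathfrak{P}_n$, $\operatorname{cdes}[\pi]=\operatorname{cdes}\pi$ is the number of $i\in[n]$ with $\pi_i>\pi_{i+1}$, indices modulo $n$ (this is rotation-invariant). $\mathbb{Q}[[t*]]$ is the $\mathbb{Q}$-algebra of formal power series in $t$ under the Hadamard product $\bigl(\sum_n a_nt^n\bigr)*\bigl(\sum_n b_nt^n\bigr)=\sum_n a_nb_nt^n$; in $\mathbb{Q}[[t*]][x]$ the variable $x$ multiplies as usual. All products in the displayed formulas are ordinary products (of rational functions expanded in $t$); the Hadamard product is used only to multiply elements of the span. $\mathbb{N}$ is the set of non-negative integers and $\mathbb{Q}[x]^{\mathbb{N}}$ is the algebra of functions $\mathbb{N}\to\mathbb{Q}[x]$ (pointwise operations) in the variable $p$; an expression in $p$ denotes the corresponding function of $p$. *)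

theory Defs
  imports
    "HOL-Library.Poly_Mapping"
    "HOL-Library.Sublist"
    "HOL-Library.Multiset"
    "HOL-Library.Function_Algebras"
    "HOL-Computational_Algebra.Polynomial"
    "HOL-Computational_Algebra.Formal_Power_Series"
begin

section \<open>Linear and cyclic permutations\<close>

definition lperm :: "nat list \<Rightarrow> bool" where
  "lperm \<pi> \<longleftrightarrow> distinct \<pi> \<and> 0 \<notin> set \<pi>"

definition ldisjoint :: "nat list \<Rightarrow> nat list \<Rightarrow> bool" where
  "ldisjoint \<pi> \<sigma> \<longleftrightarrow> set \<pi> \<inter> set \<sigma> = {}"

definition std :: "nat list \<Rightarrow> nat list" where
  "std \<pi> = map (\<lambda>a. card {b \<in> set \<pi>. b \<le> a}) \<pi>"

definition Sh :: "nat list \<Rightarrow> nat list \<Rightarrow> nat list set" where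
  "Sh \<pi> \<sigma> = {\<tau>. lperm \<tau> \<and> length \<tau> = length \<pi> + length \<sigma> \<and> subseq \<pi> \<tau> \<and> subseq \<sigma> \<tau>}"

definition cyc :: "nat list \<Rightarrow> nat list set" where
  "cyc \<pi> = {rotate k \<pi> | k. True}"

definition cperms :: "nat list set set" where
  "cperms = {cyc \<pi> | \<pi>. lperm \<pi>}"

text \<open>The common length of all representatives; see \<open>clen_cyc\<close> below.\<close>

definition clen :: "nat list set \<Rightarrow> nat" where
  "clen C = the_elem (length ` C)"

definition cSh :: "nat list set \<Rightarrow> nat list set \<Rightarrow> nat list set set" where
  "cSh C D = {cyc \<tau> | \<tau>. \<exists>\<pi>\<in>C. \<exists>\<sigma>\<in>D. \<tau> \<in> Sh \<pi> \<sigma>}"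


section \<open>Cyclic statistics and cyclic shuffle-compatibility\<close>

text \<open>A statistic is a function on sets of lists of which only the values on \<^const>\<open>cperms\<close> matter.\<close>

definition cyc_statistic :: "(nat list set \<Rightarrow> 'v) \<Rightarrow> bool" where
  "cyc_statistic cst \<longleftrightarrow>
     (\<forall>\<pi> \<sigma>. lperm \<pi> \<and> lperm \<sigma> \<and> std \<pi> = std \<sigma> \<longrightarrow> cst (cyc \<pi>) = cst (cyc \<sigma>))"

definition cyc_shuffle_compatible :: "(nat list set \<Rightarrow> 'v) \<Rightarrow> bool" where
  "cyc_shuffle_compatible cst \<longleftrightarrow> cyc_statistic cst \<and>
     (\<forall>\<pi> \<sigma> \<pi>' \<sigma>'.
        lperm \<pi> \<and> lperm \<sigma> \<and> ldisjoint \<pi> \<sigma> \<and> lperm \<pi>' \<and> lperm \<sigma>' \<and> ldisjoint \<pi>' \<sigma>' \<and>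
        cst (cyc \<pi>) = cst (cyc \<pi>') \<and> cst (cyc \<sigma>) = cst (cyc \<sigma>') \<and>
        length \<pi> = length \<pi>' \<and> length \<sigma> = length \<sigma>' \<longrightarrow>
        image_mset cst (mset_set (cSh (cyc \<pi>) (cyc \<sigma>))) =
        image_mset cst (mset_set (cSh (cyc \<pi>') (cyc \<sigma>'))))"

text \<open>Positions are counted from 0. The value on a cyclic permutation is the common value of all
  its representatives; see \<open>cdes_cyc\<close> below.\<close>

definition cdes_lin :: "nat list \<Rightarrow> nat" where
  "cdes_lin \<pi> = card {i. i < length \<pi> \<and> \<pi> ! i > \<pi> ! (Suc i mod length \<pi>)}"

definition cdes :: "nat list set \<Rightarrow> nat" where
  "cdes C = the_elem (cdes_lin ` C)"


section \<open>Algebras over the rationals\<close>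

text \<open>An associative unital \<open>\<rat>\<close>-algebra on a subset of an additive group type; addition is that of
  the type.\<close>

record 'a qalg =
  qcarrier :: "'a set"
  qmult :: "'a \<Rightarrow> 'a \<Rightarrow> 'a"
  qone :: 'a
  qscale :: "rat \<Rightarrow> 'a \<Rightarrow> 'a"

definition rat_algebra :: "'a::ab_group_add qalg \<Rightarrow> bool" where
  "rat_algebra A \<longleftrightarrow>
     vector_space (qscale A) \<and> module.subspace (qscale A) (qcarrier A) \<and>
     qone A \<in> qcarrier A \<and>
     (\<forall>u\<in>qcarrier A. \<forall>v\<in>qcarrier A. qmult A u v \<in> qcarrier A) \<and>
     (\<forall>u\<in>qcarrier A. qmult A (qone A) u = u \<and> qmult A u (qone A) = u) \<and>
     (\<forall>u\<in>qcarrier A. \<forall>v\<in>qcarrier A. \<forall>w\<in>qcarrier A.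
        qmult A (qmult A u v) w = qmult A u (qmult A v w) \<and>
        qmult A (u + v) w = qmult A u w + qmult A v w \<and>
        qmult A u (v + w) = qmult A u v + qmult A u w) \<and>
     (\<forall>q. \<forall>u\<in>qcarrier A. \<forall>v\<in>qcarrier A.
        qmult A (qscale A q u) v = qscale A q (qmult A u v) \<and>
        qmult A u (qscale A q v) = qscale A q (qmult A u v))"

definition rat_subalgebra :: "'a::ab_group_add set \<Rightarrow> 'a qalg \<Rightarrow> bool" where
  "rat_subalgebra B A \<longleftrightarrow> rat_algebra A \<and>
     B \<subseteq> qcarrier A \<and> module.subspace (qscale A) B \<and> qone A \<in> B \<and>
     (\<forall>u\<in>B. \<forall>v\<in>B. qmult A u v \<in> B)"

definition rat_algebra_iso ::
  "('a::ab_group_add \<Rightarrow> 'b::ab_group_add) \<Rightarrow> 'a qalg \<Rightarrow> 'b qalg \<Rightarrow> bool" where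
  "rat_algebra_iso \<phi> A B \<longleftrightarrow> rat_algebra A \<and> rat_algebra B \<and>
     bij_betw \<phi> (qcarrier A) (qcarrier B) \<and>
     (\<forall>u\<in>qcarrier A. \<forall>v\<in>qcarrier A. \<phi> (u + v) = \<phi> u + \<phi> v) \<and>
     (\<forall>q. \<forall>u\<in>qcarrier A. \<phi> (qscale A q u) = qscale B q (\<phi> u)) \<and>
     (\<forall>u\<in>qcarrier A. \<forall>v\<in>qcarrier A. \<phi> (qmult A u v) = qmult B (\<phi> u) (\<phi> v)) \<and>
     \<phi> (qone A) = qone B"

abbreviation qspan :: "'a::ab_group_add qalg \<Rightarrow> 'a set \<Rightarrow> 'a set" where
  "qspan A \<equiv> module.span (qscale A)"


section \<open>The cyclic shuffle algebra of a statistic\<close>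

type_synonym cyc_class = "nat list set set"

definition cyc_rel :: "(nat list set \<Rightarrow> 'v) \<Rightarrow> (nat list set \<times> nat list set) set" where
  "cyc_rel cst = {(C, D). C \<in> cperms \<and> D \<in> cperms \<and> cst C = cst D \<and> clen C = clen D}"

definition cls :: "(nat list set \<Rightarrow> 'v) \<Rightarrow> nat list set \<Rightarrow> cyc_class" where
  "cls cst C = cyc_rel cst `` {C}"

definition bas :: "(nat list set \<Rightarrow> 'v) \<Rightarrow> nat list set \<Rightarrow> cyc_class \<Rightarrow>\<^sub>0 rat" where
  "bas cst C = Poly_Mapping.single (cls cst C) 1"

definition cyc_scale :: "rat \<Rightarrow> (cyc_class \<Rightarrow>\<^sub>0 rat) \<Rightarrow> (cyc_class \<Rightarrow>\<^sub>0 rat)" where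
  "cyc_scale q = Poly_Mapping.map ((*) q)"

text \<open>The product of two classes is computed with disjoint representatives. If the statistic is
  cyclic shuffle-compatible, the result does not depend on their choice; see \<open>cls_mult_eq\<close> and
  \<open>cyc_mult_bas\<close> below.\<close>

definition cls_mult ::
  "(nat list set \<Rightarrow> 'v) \<Rightarrow> cyc_class \<Rightarrow> cyc_class \<Rightarrow> cyc_class \<Rightarrow>\<^sub>0 rat" where
  "cls_mult cst c d = (THE w. \<exists>\<pi> \<sigma>. lperm \<pi> \<and> lperm \<sigma> \<and> ldisjoint \<pi> \<sigma> \<and>
     cls cst (cyc \<pi>) = c \<and> cls cst (cyc \<sigma>) = d \<and>
     w = (\<Sum>C\<in>cSh (cyc \<pi>) (cyc \<sigma>). bas cst C))"

definition cyc_mult ::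
  "(nat list set \<Rightarrow> 'v) \<Rightarrow> (cyc_class \<Rightarrow>\<^sub>0 rat) \<Rightarrow> (cyc_class \<Rightarrow>\<^sub>0 rat) \<Rightarrow> cyc_class \<Rightarrow>\<^sub>0 rat" where
  "cyc_mult cst u v =
     (\<Sum>c\<in>Poly_Mapping.keys u. \<Sum>d\<in>Poly_Mapping.keys v.
        cyc_scale (Poly_Mapping.lookup u c * Poly_Mapping.lookup v d) (cls_mult cst c d))"

definition cyc_algebra :: "(nat list set \<Rightarrow> 'v) \<Rightarrow> (cyc_class \<Rightarrow>\<^sub>0 rat) qalg" where
  "cyc_algebra cst =
     \<lparr>qcarrier = {u. Poly_Mapping.keys u \<subseteq> cperms // cyc_rel cst},
      qmult = cyc_mult cst, qone = bas cst (cyc []), qscale = cyc_scale\<rparr>"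

definition cyc_homog :: "(nat list set \<Rightarrow> 'v) \<Rightarrow> nat \<Rightarrow> (cyc_class \<Rightarrow>\<^sub>0 rat) set" where
  "cyc_homog cst n =
     qspan (cyc_algebra cst) {bas cst (cyc \<pi>) | \<pi>. lperm \<pi> \<and> length \<pi> = n}"


section \<open>The target algebras\<close>

text \<open>A copy of the type of formal power series, with the Hadamard product as multiplication.\<close>

typedef 'a hfps = "UNIV :: 'a fps set"
  morphisms fps_of_hfps hfps ..

setup_lifting type_definition_hfps

instantiation hfps :: (comm_ring_1) comm_ring_1
begin

lift_definition zero_hfps :: "'a hfps" is 0 .
lift_definition one_hfps :: "'a hfps" is "Abs_fps (\<lambda>_. 1)" .
lift_definition plus_hfps :: "'a hfps \<Rightarrow> 'a hfps \<Rightarrow> 'a hfps" is "(+)" .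
lift_definition minus_hfps :: "'a hfps \<Rightarrow> 'a hfps \<Rightarrow> 'a hfps" is "(-)" .
lift_definition uminus_hfps :: "'a hfps \<Rightarrow> 'a hfps" is uminus .
lift_definition times_hfps :: "'a hfps \<Rightarrow> 'a hfps \<Rightarrow> 'a hfps"
  is "\<lambda>f g. Abs_fps (\<lambda>n. fps_nth f n * fps_nth g n)" .

instance
  by standard (transfer; simp add: fps_eq_iff algebra_simps)+

end

lift_definition hfps_scale :: "rat \<Rightarrow> rat hfps \<Rightarrow> rat hfps" is "\<lambda>q f. fps_const q * f" .

definition hadamard_algebra :: "rat hfps poly qalg" where
  "hadamard_algebra =
     \<lparr>qcarrier = UNIV, qmult = (*), qone = 1, qscale = (\<lambda>q. map_poly (hfps_scale q))\<rparr>"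

definition poly_fun_algebra :: "(nat \<Rightarrow> rat poly) qalg" where
  "poly_fun_algebra =
     \<lparr>qcarrier = UNIV, qmult = (*), qone = 1, qscale = (\<lambda>q f p. smult q (f p))\<rparr>"

definition cdes_series :: "nat \<Rightarrow> nat \<Rightarrow> rat hfps poly" where
  "cdes_series n k =
     monom (hfps ((of_nat k * fps_X ^ k + (of_nat n - of_nat k) * fps_X ^ (k + 1))
                  / (1 - fps_X) ^ (n + 1))) n"

text \<open>Only used for \<open>k < n\<close>, so the subtraction of natural numbers is never truncated.\<close>

definition cdes_binomial :: "nat \<Rightarrow> nat \<Rightarrow> nat \<Rightarrow> rat poly" where
  "cdes_binomial n k = (\<lambda>p. monom (of_nat (((p + n - k - 1) choose (n - 1)) * p)) n)"


section \<open>Well-definedness\<close>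

lemma cyc_self: "\<pi> \<in> cyc \<pi>"
  unfolding cyc_def by (auto intro: exI[of _ 0])

lemma clen_cyc: "clen (cyc \<pi>) = length \<pi>"
proof -
  have "length ` cyc \<pi> = {length \<pi>}"
    using cyc_self[of \<pi>] by (auto simp: cyc_def)
  then show ?thesis by (simp add: clen_def)
qed

lemma cdes_lin_rotate1: "cdes_lin (rotate1 \<pi>) = cdes_lin \<pi>"
proof (cases "\<pi> = []")
  case False
  define n where "n = length \<pi>"
  have n: "n > 0" using False by (simp add: n_def)
  have nth: "rotate1 \<pi> ! i = \<pi> ! (Suc i mod n)" if "i < n" for i
    using that nth_rotate1[of i \<pi>] by (simp add: n_def)
  let ?A = "{i. i < n \<and> rotate1 \<pi> ! i > rotate1 \<pi> ! (Suc i mod n)}"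
  let ?B = "{i. i < n \<and> \<pi> ! i > \<pi> ! (Suc i mod n)}"
  have inj: "inj_on (\<lambda>i. Suc i mod n) {..<n}"
  proof (rule inj_onI)
    fix i j assume "i \<in> {..<n}" "j \<in> {..<n}" "Suc i mod n = Suc j mod n"
    then show "i = j" by (cases "Suc i = n"; cases "Suc j = n") auto
  qed
  have surj: "(\<lambda>i. Suc i mod n) ` {..<n} = {..<n}"
    by (rule endo_inj_surj) (use inj n in auto)
  have "bij_betw (\<lambda>i. Suc i mod n) ?A ?B"
    unfolding bij_betw_def
  proof
    show "inj_on (\<lambda>i. Suc i mod n) ?A" by (rule inj_on_subset[OF inj]) auto
    have iff: "i \<in> ?A \<longleftrightarrow> Suc i mod n \<in> ?B" if "i < n" for i
      using that n nth[of i] nth[of "Suc i mod n"] by (simp add: mod_Suc_eq)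
    show "(\<lambda>i. Suc i mod n) ` ?A = ?B"
    proof (intro equalityI subsetI)
      fix j assume j: "j \<in> ?B"
      then obtain i where i: "i < n" "j = Suc i mod n" using surj by blast
      then show "j \<in> (\<lambda>i. Suc i mod n) ` ?A" using iff[of i] j by blast
    qed (use iff in auto)
  qed
  then show ?thesis
    by (simp add: cdes_lin_def bij_betw_same_card flip: n_def)
qed simp

lemma cdes_lin_rotate: "cdes_lin (rotate k \<pi>) = cdes_lin \<pi>"
  by (induction k) (simp_all add: cdes_lin_rotate1)

lemma cdes_cyc: "cdes (cyc \<pi>) = cdes_lin \<pi>"
proof -
  have "cdes_lin ` cyc \<pi> = {cdes_lin \<pi>}"
    using cyc_self[of \<pi>] by (auto simp: cyc_def cdes_lin_rotate)
  then show ?thesis by (simp add: cdes_def)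
qed

lemma set_Sh:
  assumes "ldisjoint \<pi> \<sigma>" "lperm \<pi>" "lperm \<sigma>" "\<tau> \<in> Sh \<pi> \<sigma>"
  shows "set \<tau> = set \<pi> \<union> set \<sigma>"
proof -
  have sub: "set \<pi> \<union> set \<sigma> \<subseteq> set \<tau>"
    using assms(4) by (auto simp: Sh_def dest: list_emb_set)
  have "card (set \<pi> \<union> set \<sigma>) = card (set \<tau>)"
    using assms by (simp add: Sh_def lperm_def ldisjoint_def card_Un_disjoint distinct_card)
  from card_subset_eq[OF finite_set sub this] show ?thesis by (rule sym)
qed

lemma finite_cSh:
  assumes "lperm \<pi>" "lperm \<sigma>" "ldisjoint \<pi> \<sigma>"
  shows "finite (cSh (cyc \<pi>) (cyc \<sigma>))"
proof -
  have "cSh (cyc \<pi>) (cyc \<sigma>) \<subseteq>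
      cyc ` {\<tau>. set \<tau> \<subseteq> set \<pi> \<union> set \<sigma> \<and> length \<tau> = length \<pi> + length \<sigma>}"
  proof
    fix C assume "C \<in> cSh (cyc \<pi>) (cyc \<sigma>)"
    then obtain \<tau> j k where *: "C = cyc \<tau>" "\<tau> \<in> Sh (rotate j \<pi>) (rotate k \<sigma>)"
      by (auto simp: cSh_def cyc_def)
    have "set \<tau> = set (rotate j \<pi>) \<union> set (rotate k \<sigma>)"
      by (rule set_Sh[OF _ _ _ *(2)]) (use assms in \<open>auto simp: lperm_def ldisjoint_def\<close>)
    with * show "C \<in> cyc ` {\<tau>. set \<tau> \<subseteq> set \<pi> \<union> set \<sigma> \<and> length \<tau> = length \<pi> + length \<sigma>}"
      by (auto simp: Sh_def)
  qed
  then show ?thesis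
    by (rule finite_subset) (intro finite_imageI finite_lists_length_eq, simp)
qed

lemma cSh_D:
  assumes "C \<in> cSh (cyc \<pi>) (cyc \<sigma>)"
  shows "C \<in> cperms" "clen C = length \<pi> + length \<sigma>"
  using assms by (auto simp: cSh_def cyc_def[of \<pi>] cyc_def[of \<sigma>] cperms_def Sh_def clen_cyc)

lemma cls_eq_iff:
  assumes "C \<in> cperms" "D \<in> cperms"
  shows "cls cst C = cls cst D \<longleftrightarrow> cst C = cst D \<and> clen C = clen D"
  using assms unfolding cls_def cyc_rel_def by (auto simp: set_eq_iff)

lemma cls_mult_eq:
  assumes "cyc_shuffle_compatible cst" "lperm \<pi>" "lperm \<sigma>" "ldisjoint \<pi> \<sigma>"
  shows "cls_mult cst (cls cst (cyc \<pi>)) (cls cst (cyc \<sigma>)) =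
           (\<Sum>C\<in>cSh (cyc \<pi>) (cyc \<sigma>). bas cst C)"
proof -
  have cp: "cyc \<rho> \<in> cperms" if "lperm \<rho>" for \<rho> using that by (auto simp: cperms_def)
  define F where
    "F N s = (Poly_Mapping.single {D \<in> cperms. cst D = s \<and> clen D = N} (1::rat))" for N s
  have sum_eq: "(\<Sum>C\<in>cSh (cyc \<alpha>) (cyc \<beta>). bas cst C) =
      (\<Sum>s\<in>#image_mset cst (mset_set (cSh (cyc \<alpha>) (cyc \<beta>))). F (length \<alpha> + length \<beta>) s)" for \<alpha> \<beta>
  proof -
    have "bas cst C = F (length \<alpha> + length \<beta>) (cst C)" if "C \<in> cSh (cyc \<alpha>) (cyc \<beta>)" for C
      using cSh_D[OF that] unfolding bas_def F_def cls_def cyc_rel_def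
      by (auto intro!: arg_cong[of _ _ "\<lambda>X. Poly_Mapping.single X 1"])
    then show ?thesis
      by (simp add: sum_unfold_sum_mset multiset.map_comp o_def cong: sum.cong)
  qed
  show ?thesis
    unfolding cls_mult_def
  proof (rule the_equality)
    show "\<exists>\<alpha> \<beta>. lperm \<alpha> \<and> lperm \<beta> \<and> ldisjoint \<alpha> \<beta> \<and> cls cst (cyc \<alpha>) = cls cst (cyc \<pi>) \<and>
        cls cst (cyc \<beta>) = cls cst (cyc \<sigma>) \<and>
        (\<Sum>C\<in>cSh (cyc \<pi>) (cyc \<sigma>). bas cst C) = (\<Sum>C\<in>cSh (cyc \<alpha>) (cyc \<beta>). bas cst C)"
      using assms by blast
  next
    fix w
    assume "\<exists>\<alpha> \<beta>. lperm \<alpha> \<and> lperm \<beta> \<and> ldisjoint \<alpha> \<beta> \<and> cls cst (cyc \<alpha>) = cls cst (cyc \<pi>) \<and>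
        cls cst (cyc \<beta>) = cls cst (cyc \<sigma>) \<and> w = (\<Sum>C\<in>cSh (cyc \<alpha>) (cyc \<beta>). bas cst C)"
    then obtain \<alpha> \<beta> where ab: "lperm \<alpha>" "lperm \<beta>" "ldisjoint \<alpha> \<beta>"
      "cls cst (cyc \<alpha>) = cls cst (cyc \<pi>)" "cls cst (cyc \<beta>) = cls cst (cyc \<sigma>)"
      "w = (\<Sum>C\<in>cSh (cyc \<alpha>) (cyc \<beta>). bas cst C)" by blast
    have eqs: "cst (cyc \<alpha>) = cst (cyc \<pi>)" "length \<alpha> = length \<pi>"
      "cst (cyc \<beta>) = cst (cyc \<sigma>)" "length \<beta> = length \<sigma>"
      using ab(4,5) cls_eq_iff[OF cp[OF ab(1)] cp[OF assms(2)], of cst]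
        cls_eq_iff[OF cp[OF ab(2)] cp[OF assms(3)], of cst]
      by (simp_all add: clen_cyc)
    have "image_mset cst (mset_set (cSh (cyc \<alpha>) (cyc \<beta>))) =
          image_mset cst (mset_set (cSh (cyc \<pi>) (cyc \<sigma>)))"
      using assms ab(1-3) eqs unfolding cyc_shuffle_compatible_def by blast
    then show "w = (\<Sum>C\<in>cSh (cyc \<pi>) (cyc \<sigma>). bas cst C)"
      by (simp add: ab(6) sum_eq eqs)
  qed
qed

lemma cyc_mult_bas:
  assumes "cyc_shuffle_compatible cst" "lperm \<pi>" "lperm \<sigma>" "ldisjoint \<pi> \<sigma>"
  shows "cyc_mult cst (bas cst (cyc \<pi>)) (bas cst (cyc \<sigma>)) =
           (\<Sum>C\<in>cSh (cyc \<pi>) (cyc \<sigma>). bas cst C)"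
proof -
  have "cyc_scale 1 u = u" for u
    by (rule poly_mapping_eqI) (simp add: cyc_scale_def Poly_Mapping.map.rep_eq when_def)
  then show ?thesis
    by (simp add: cyc_mult_def bas_def[of cst "cyc \<pi>"] bas_def[of cst "cyc \<sigma>"] cls_mult_eq[OF assms])
qed

end

theory Submission
  imports Defs "HOL-Library.FuncSet"
begin

text \<open>
  The proof is a count. A function \<open>h\<close> from a finite set \<open>A\<close> of letters to \<open>{0, ..., p - 1}\<close>
  arranges \<open>A\<close> into one list: sort the letters by \<open>h\<close>, and letters with equal value by size.
  Let \<open>L p C\<close> be the set of those \<open>h\<close> whose arrangement lies in the cyclic permutation \<open>C\<close>.
  Two facts about \<open>L\<close> carry the theorem.

  First, for nonempty \<open>\<pi>\<close> of length \<open>n\<close> with cyclic descent number \<open>k\<close>,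
  \<open>card (L p [\<pi>])\<close> is exactly the value
  \<open>p * ((p + n - k - 1) choose (n - 1))\<close> in part (c) (\<open>card_cyclic_labelings\<close>). For a single list \<open>\<rho>\<close> with \<open>d\<close> linear
  descents there are \<open>(p + n - 1 - d) choose n\<close> functions arranging the letters as \<open>\<rho>\<close>. Among
  the \<open>n\<close> rotations of \<open>\<pi>\<close>, exactly \<open>k\<close> lose a cyclic descent at the cut, so the total is
  \<open>k * ((p + n - k) choose n) + (n - k) * ((p + n - k - 1) choose n)\<close>. This sum equals the
  product above, and it is also the coefficient of \<open>t ^ p\<close> in the power series of part (b), so
  that (b) and (c) are the same statement, read off coefficient by coefficient.

  Second, if \<open>A\<close> and \<open>B\<close> are the disjoint letter sets of \<open>\<pi>\<close> and \<open>\<sigma>\<close>, then a function on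
  \<open>A \<union> B\<close> is a pair of functions on \<open>A\<close> and \<open>B\<close>, and its arrangement restricted to \<open>A\<close> is
  the arrangement for the first function, likewise for \<open>B\<close>. A cyclic permutation of \<open>A \<union> B\<close> is a
  cyclic shuffle of \<open>[\<pi>]\<close> and \<open>[\<sigma>]\<close> exactly when it restricts to both. Hence
  \<open>card (L p [\<pi>]) * card (L p [\<sigma>])\<close> is the sum of \<open>card (L p C)\<close> over all
  cyclic shuffles \<open>C\<close> (\<open>card_labelings_mult\<close>): the functions in (c) multiply like the classes.

  For fixed \<open>n \<ge> 2\<close> these functions are linearly independent, because the one for \<open>k\<close> vanishes at
  all \<open>p < k\<close> but not at \<open>p = k\<close>; lengths 0 and 1 have a single nonzero function each, and the
  powers of \<open>x\<close> separate the lengths. Everything else is formal and holds for every statistic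
  (locale \<open>cyc_realization\<close>): if linearly independent elements indexed by length and
  statistic multiply like the classes, then the multiset of statistics of the cyclic shuffles can be
  read off from a product, which is shuffle-compatibility; and the algebra laws of the shuffle
  algebra are pulled back from the target along the injective linear map. Part (d) counts
  the values \<open>1, ..., n - 1\<close> that \<open>cdes\<close> takes on length \<open>n\<close>.
\<close>

section \<open>Letters arranged by a function\<close>

definition key_less :: "(nat \<Rightarrow> nat) \<Rightarrow> nat \<Rightarrow> nat \<Rightarrow> bool" where
  "key_less h a b \<longleftrightarrow> h a < h b \<or> h a = h b \<and> a < b"

lemma key_less_trans: "key_less h a b \<Longrightarrow> key_less h b c \<Longrightarrow> key_less h a c"
  by (auto simp: key_less_def)

lemma key_less_total: "a \<noteq> b \<Longrightarrow> key_less h a b \<or> key_less h b a"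
  by (auto simp: key_less_def)

lemma key_less_asym: "key_less h a b \<Longrightarrow> \<not> key_less h b a"
  by (auto simp: key_less_def)

lemma key_less_irrefl [simp]: "\<not> key_less h a a"
  by (simp add: key_less_def)

abbreviation arranges :: "(nat \<Rightarrow> nat) \<Rightarrow> nat list \<Rightarrow> bool" where
  "arranges h \<equiv> sorted_wrt (key_less h)"

lemma arranges_cong:
  assumes "\<And>a. a \<in> set \<tau> \<Longrightarrow> f a = h a"
  shows "arranges f \<tau> \<longleftrightarrow> arranges h \<tau>"
  using assms by (induction \<tau>) (auto simp: key_less_def)

text \<open>
  The relation is a strict linear order on the letters, so every finite set of letters has
  exactly one arrangement; the next two lemmas give existence and uniqueness.
\<close>
lemma ex_arrangement:
  assumes "finite A"
  shows "\<exists>\<tau>. set \<tau> = A \<and> distinct \<tau> \<and> arranges h \<tau>"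
  using assms
proof (induction A)
  case (insert x A)
  then obtain \<tau> where t: "set \<tau> = A" "distinct \<tau>" "arranges h \<tau>" by blast
  let ?u = "filter (\<lambda>a. key_less h a x) \<tau> @ x # filter (\<lambda>a. key_less h x a) \<tau>"
  have "set ?u = insert x A"
    using t(1) insert.hyps key_less_total[of _ x h] by auto
  moreover have "distinct ?u"
    using t insert.hyps by (auto dest: key_less_asym)
  moreover have "arranges h ?u"
    using t by (auto simp: sorted_wrt_append sorted_wrt_filter intro: key_less_trans)
  ultimately show ?case by blast
qed simp

lemma arrangement_unique:
  assumes "arranges h \<tau>" "arranges h \<rho>" "set \<tau> = set \<rho>"
  shows "\<tau> = \<rho>"
  using assms
proof (induction \<tau> arbitrary: \<rho>)
  case (Cons a \<tau>)
  then obtain b \<rho>' where r: "\<rho> = b # \<rho>'" by (cases \<rho>) auto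
  have nin: "a \<notin> set \<tau>" "b \<notin> set \<rho>'"
    using Cons.prems unfolding r by auto
  have ab: "a = b"
  proof (rule ccontr)
    assume "a \<noteq> b"
    then have "b \<in> set \<tau>" "a \<in> set \<rho>'" using Cons.prems(3) unfolding r by auto
    then show False using Cons.prems(1,2) key_less_asym[of h a b] unfolding r by auto
  qed
  with nin have "set \<tau> = set \<rho>'" using Cons.prems(3) unfolding r by auto
  then show ?case using Cons ab r by auto
qed simp

section \<open>Rotations and cyclic shuffles\<close>

lemma rotate_filter: "\<exists>j. filter P (rotate k xs) = rotate j (filter P xs)"
proof (induction k)
  case (Suc k)
  then obtain j where j: "filter P (rotate k xs) = rotate j (filter P xs)" by blast
  have "filter P (rotate1 ys) = filter P ys \<or> filter P (rotate1 ys) = rotate1 (filter P ys)" for ys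
    by (cases ys) auto
  from this[of "rotate k xs"] show ?case
    by (metis j rotate_Suc)
qed (auto intro: exI[of _ 0])

lemma cyc_eqI:
  assumes "\<rho> \<in> cyc \<pi>"
  shows "cyc \<rho> = cyc \<pi>"
proof -
  obtain k where k: "\<rho> = rotate k \<pi>" using assms by (auto simp: cyc_def)
  have "\<exists>j. rotate j \<rho> = \<pi>"
  proof (cases "\<pi> = []")
    case False
    have "rotate (length \<pi> - k mod length \<pi>) \<rho> = rotate (length \<pi> - k mod length \<pi> + k mod length \<pi>) \<pi>"
      by (simp add: k rotate_rotate) (metis rotate_conv_mod rotate_rotate)
    also have "\<dots> = \<pi>" using False by (simp add: less_imp_le)
    finally show ?thesis by blast
  qed (simp add: k)
  then obtain j where j: "\<pi> = rotate j \<rho>" by metis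
  show ?thesis
    using j k unfolding cyc_def by auto (metis rotate_rotate)+
qed

lemma cyc_eq_iff: "cyc \<rho> = cyc \<pi> \<longleftrightarrow> \<rho> \<in> cyc \<pi>"
  using cyc_eqI cyc_self by blast

lemma set_cyc: "\<rho> \<in> cyc \<pi> \<Longrightarrow> set \<rho> = set \<pi>" and distinct_cyc: "\<rho> \<in> cyc \<pi> \<Longrightarrow> distinct \<rho> = distinct \<pi>"
  and length_cyc: "\<rho> \<in> cyc \<pi> \<Longrightarrow> length \<rho> = length \<pi>"
  by (auto simp: cyc_def)

lemma filter_cyc: "\<rho> \<in> cyc \<pi> \<Longrightarrow> filter P \<rho> \<in> cyc (filter P \<pi>)"
  using rotate_filter[of P _ \<pi>] by (auto simp: cyc_def)

lemma filter_subseq: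
  assumes "subseq \<pi> \<tau>" "distinct \<tau>"
  shows "filter (\<lambda>a. a \<in> set \<pi>) \<tau> = \<pi>"
  using assms
proof (induction rule: list_emb.induct)
  case (list_emb_Cons2 x y xs ys)
  then have "filter (\<lambda>a. a \<in> set (x # xs)) ys = filter (\<lambda>a. a \<in> set xs) ys"
    by (intro filter_cong) auto
  then show ?case using list_emb_Cons2 by simp
qed (auto dest: list_emb_set)

text \<open>
  Deleting letters commutes with rotation up to a rotation, so whether \<open>[\<tau>]\<close> is a cyclic shuffle
  can be tested on any representative, by deleting the letters of one factor.
\<close>
lemma mem_cSh_iff:
  assumes "lperm \<pi>" "lperm \<sigma>" "ldisjoint \<pi> \<sigma>" and \<tau>: "distinct \<tau>" "set \<tau> = set \<pi> \<union> set \<sigma>"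
  shows "cyc \<tau> \<in> cSh (cyc \<pi>) (cyc \<sigma>) \<longleftrightarrow>
    filter (\<lambda>a. a \<in> set \<pi>) \<tau> \<in> cyc \<pi> \<and> filter (\<lambda>a. a \<in> set \<sigma>) \<tau> \<in> cyc \<sigma>"
proof
  assume "cyc \<tau> \<in> cSh (cyc \<pi>) (cyc \<sigma>)"
  then obtain \<rho> \<pi>' \<sigma>' where r: "cyc \<tau> = cyc \<rho>" "\<pi>' \<in> cyc \<pi>" "\<sigma>' \<in> cyc \<sigma>" "\<rho> \<in> Sh \<pi>' \<sigma>'"
    by (auto simp: cSh_def)
  have t: "\<tau> \<in> cyc \<rho>" using r(1) by (simp add: cyc_eq_iff)
  have "filter (\<lambda>a. a \<in> set \<pi>) \<rho> = \<pi>'" "filter (\<lambda>a. a \<in> set \<sigma>) \<rho> = \<sigma>'"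
    using filter_subseq[of \<pi>' \<rho>] filter_subseq[of \<sigma>' \<rho>] r set_cyc[OF r(2)] set_cyc[OF r(3)]
    by (auto simp: Sh_def lperm_def)
  then show "filter (\<lambda>a. a \<in> set \<pi>) \<tau> \<in> cyc \<pi> \<and> filter (\<lambda>a. a \<in> set \<sigma>) \<tau> \<in> cyc \<sigma>"
    using filter_cyc[OF t, of "\<lambda>a. a \<in> set \<pi>"] filter_cyc[OF t, of "\<lambda>a. a \<in> set \<sigma>"] r(2,3) cyc_eqI by metis
next
  assume f: "filter (\<lambda>a. a \<in> set \<pi>) \<tau> \<in> cyc \<pi> \<and> filter (\<lambda>a. a \<in> set \<sigma>) \<tau> \<in> cyc \<sigma>"
  have "length \<tau> = card (set \<pi>) + card (set \<sigma>)"
    using assms by (simp add: card_Un_disjoint ldisjoint_def flip: distinct_card)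
  then have "length \<tau> = length (filter (\<lambda>a. a \<in> set \<pi>) \<tau>) + length (filter (\<lambda>a. a \<in> set \<sigma>) \<tau>)"
    using f length_cyc assms(1,2) by (auto simp: distinct_card lperm_def)
  then have "\<tau> \<in> Sh (filter (\<lambda>a. a \<in> set \<pi>) \<tau>) (filter (\<lambda>a. a \<in> set \<sigma>) \<tau>)"
    using assms by (auto simp: Sh_def lperm_def)
  then show "cyc \<tau> \<in> cSh (cyc \<pi>) (cyc \<sigma>)" using f by (auto simp: cSh_def)
qed

lemma cSh_representative:
  assumes "lperm \<pi>" "lperm \<sigma>" "ldisjoint \<pi> \<sigma>" "C \<in> cSh (cyc \<pi>) (cyc \<sigma>)"
  shows "\<exists>\<tau>. lperm \<tau> \<and> set \<tau> = set \<pi> \<union> set \<sigma> \<and> C = cyc \<tau>"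
proof -
  obtain \<tau> \<pi>' \<sigma>' where t: "C = cyc \<tau>" "\<pi>' \<in> cyc \<pi>" "\<sigma>' \<in> cyc \<sigma>" "\<tau> \<in> Sh \<pi>' \<sigma>'"
    using assms(4) by (auto simp: cSh_def)
  have "set \<tau> = set \<pi>' \<union> set \<sigma>'"
    by (rule set_Sh[OF _ _ _ t(4)])
      (use t(2,3) assms set_cyc distinct_cyc in \<open>auto simp: ldisjoint_def lperm_def\<close>)
  then show ?thesis using t set_cyc by (auto simp: Sh_def)
qed

section \<open>The product rule for labelings\<close>

definition labelings :: "nat set \<Rightarrow> nat \<Rightarrow> nat list set \<Rightarrow> (nat \<Rightarrow> nat) set" where
  "labelings A p C = {h \<in> A \<rightarrow>\<^sub>E {..<p}. \<exists>\<rho>\<in>C. arranges h \<rho>}"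

lemma finite_labelings: "finite A \<Longrightarrow> finite (labelings A p C)"
  by (rule finite_subset[of _ "A \<rightarrow>\<^sub>E {..<p}"]) (auto simp: labelings_def intro: finite_PiE)

lemma labelings_cyc_iff:
  assumes "arranges h \<tau>" "set \<tau> = set \<pi>"
  shows "(\<exists>\<rho>\<in>cyc \<pi>. arranges h \<rho>) \<longleftrightarrow> \<tau> \<in> cyc \<pi>"
  using assms arrangement_unique[OF assms(1)] set_cyc by metis

text \<open>
  Restriction to the two letter sets is a bijection from the labelings whose arrangement is in some
  cyclic shuffle to the pairs of labelings of the factors. The sets for distinct cyclic shuffles are
  disjoint because arrangements are unique.
\<close>
lemma card_labelings_mult:
  assumes \<pi>: "lperm \<pi>" and \<sigma>: "lperm \<sigma>" and disj: "ldisjoint \<pi> \<sigma>"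
  shows "card (labelings (set \<pi>) p (cyc \<pi>)) * card (labelings (set \<sigma>) p (cyc \<sigma>)) =
    (\<Sum>C\<in>cSh (cyc \<pi>) (cyc \<sigma>). card (labelings (set \<pi> \<union> set \<sigma>) p C))"
proof -
  let ?A = "set \<pi>" and ?B = "set \<sigma>" and ?S = "cSh (cyc \<pi>) (cyc \<sigma>)"
  have AB: "?A \<inter> ?B = {}" using disj by (simp add: ldisjoint_def)
  have rep: "\<exists>\<tau>. C = cyc \<tau> \<and> distinct \<tau> \<and> set \<tau> = ?A \<union> ?B" if "C \<in> ?S" for C
    using cSh_representative[OF \<pi> \<sigma> disj that] by (auto simp: lperm_def)
  have dis: "labelings (?A \<union> ?B) p C \<inter> labelings (?A \<union> ?B) p D = {}"
    if CD: "C \<in> ?S" "D \<in> ?S" "C \<noteq> D" for C D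
  proof (rule ccontr)
    assume "labelings (?A \<union> ?B) p C \<inter> labelings (?A \<union> ?B) p D \<noteq> {}"
    then obtain h \<rho> \<rho>' where "arranges h \<rho>" "\<rho> \<in> C" "arranges h \<rho>'" "\<rho>' \<in> D"
      by (auto simp: labelings_def)
    moreover obtain \<tau> \<tau>' where "C = cyc \<tau>" "set \<tau> = ?A \<union> ?B" "D = cyc \<tau>'" "set \<tau>' = ?A \<union> ?B"
      using rep[OF CD(1)] rep[OF CD(2)] by blast
    ultimately show False using CD(3) arrangement_unique set_cyc cyc_eqI by metis
  qed
  have split: "(\<exists>C\<in>?S. \<exists>\<rho>\<in>C. arranges h \<rho>) \<longleftrightarrow>
      (\<exists>\<rho>\<in>cyc \<pi>. arranges h \<rho>) \<and> (\<exists>\<rho>\<in>cyc \<sigma>. arranges h \<rho>)" for h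
  proof -
    obtain \<tau> where t: "set \<tau> = ?A \<union> ?B" "distinct \<tau>" "arranges h \<tau>"
      using ex_arrangement[of "?A \<union> ?B" h] by auto
    have "(\<exists>C\<in>?S. \<exists>\<rho>\<in>C. arranges h \<rho>) \<longleftrightarrow> cyc \<tau> \<in> ?S"
      using rep t labelings_cyc_iff[OF t(3)] cyc_eqI cyc_self by metis
    also have "\<dots> \<longleftrightarrow> filter (\<lambda>a. a \<in> ?A) \<tau> \<in> cyc \<pi> \<and> filter (\<lambda>a. a \<in> ?B) \<tau> \<in> cyc \<sigma>"
      by (rule mem_cSh_iff[OF \<pi> \<sigma> disj t(2,1)])
    also have "filter (\<lambda>a. a \<in> ?A) \<tau> \<in> cyc \<pi> \<longleftrightarrow> (\<exists>\<rho>\<in>cyc \<pi>. arranges h \<rho>)"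
      by (rule labelings_cyc_iff[symmetric]) (use t in \<open>auto simp: sorted_wrt_filter\<close>)
    also have "filter (\<lambda>a. a \<in> ?B) \<tau> \<in> cyc \<sigma> \<longleftrightarrow> (\<exists>\<rho>\<in>cyc \<sigma>. arranges h \<rho>)"
      by (rule labelings_cyc_iff[symmetric]) (use t in \<open>auto simp: sorted_wrt_filter\<close>)
    finally show ?thesis .
  qed
  have cong: "(\<exists>\<rho>\<in>cyc \<alpha>. arranges f \<rho>) \<longleftrightarrow> (\<exists>\<rho>\<in>cyc \<alpha>. arranges h \<rho>)"
    if "\<And>a. a \<in> set \<alpha> \<Longrightarrow> f a = h a" for \<alpha> f h
    using that arranges_cong[of _ f h] set_cyc by metis
  let ?m = "\<lambda>(f, g) a. if a \<in> ?A then f a else if a \<in> ?B then g a else undefined"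
  have "bij_betw (\<lambda>h. (restrict h ?A, restrict h ?B)) (\<Union>C\<in>?S. labelings (?A \<union> ?B) p C)
      (labelings ?A p (cyc \<pi>) \<times> labelings ?B p (cyc \<sigma>))"
  proof (rule bij_betw_byWitness[where f' = ?m])
    show "\<forall>h\<in>(\<Union>C\<in>?S. labelings (?A \<union> ?B) p C). ?m (restrict h ?A, restrict h ?B) = h"
      by (auto simp: labelings_def PiE_def extensional_def fun_eq_iff)
    show "\<forall>q\<in>labelings ?A p (cyc \<pi>) \<times> labelings ?B p (cyc \<sigma>).
        (restrict (?m q) ?A, restrict (?m q) ?B) = q"
      using AB by (auto simp: labelings_def PiE_def extensional_def fun_eq_iff)
    show "(\<lambda>h. (restrict h ?A, restrict h ?B)) ` (\<Union>C\<in>?S. labelings (?A \<union> ?B) p C)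
        \<subseteq> labelings ?A p (cyc \<pi>) \<times> labelings ?B p (cyc \<sigma>)"
    proof clarify
      fix h C assume "C \<in> ?S" "h \<in> labelings (?A \<union> ?B) p C"
      then have h: "h \<in> ?A \<union> ?B \<rightarrow>\<^sub>E {..<p}" "\<exists>C\<in>?S. \<exists>\<rho>\<in>C. arranges h \<rho>"
        by (auto simp: labelings_def)
      with split[of h] cong[of \<pi> "restrict h ?A" h] cong[of \<sigma> "restrict h ?B" h]
      show "restrict h ?A \<in> labelings ?A p (cyc \<pi>) \<and> restrict h ?B \<in> labelings ?B p (cyc \<sigma>)"
        by (auto simp: labelings_def)
    qed
    show "?m ` (labelings ?A p (cyc \<pi>) \<times> labelings ?B p (cyc \<sigma>))
        \<subseteq> (\<Union>C\<in>?S. labelings (?A \<union> ?B) p C)"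
    proof (rule image_subsetI)
      fix q assume q: "q \<in> labelings ?A p (cyc \<pi>) \<times> labelings ?B p (cyc \<sigma>)"
      obtain f g where fg: "q = (f, g)" by (cases q)
      have "\<exists>C\<in>?S. \<exists>\<rho>\<in>C. arranges (?m q) \<rho>"
        unfolding split
      proof
        have "\<And>a. a \<in> ?A \<Longrightarrow> ?m q a = f a" "\<And>a. a \<in> ?B \<Longrightarrow> ?m q a = g a"
          using AB by (auto simp: fg)
        then have "(\<exists>\<rho>\<in>cyc \<pi>. arranges (?m q) \<rho>) = (\<exists>\<rho>\<in>cyc \<pi>. arranges f \<rho>)"
          "(\<exists>\<rho>\<in>cyc \<sigma>. arranges (?m q) \<rho>) = (\<exists>\<rho>\<in>cyc \<sigma>. arranges g \<rho>)"
          by (intro cong; simp)+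
        then show "\<exists>\<rho>\<in>cyc \<pi>. arranges (?m q) \<rho>" "\<exists>\<rho>\<in>cyc \<sigma>. arranges (?m q) \<rho>"
          using q by (simp_all add: labelings_def fg)
      qed
      then show "?m q \<in> (\<Union>C\<in>?S. labelings (?A \<union> ?B) p C)"
        using q by (auto simp: labelings_def fg PiE_def extensional_def split: if_splits)
    qed
  qed
  then have "card (\<Union>C\<in>?S. labelings (?A \<union> ?B) p C) =
      card (labelings ?A p (cyc \<pi>) \<times> labelings ?B p (cyc \<sigma>))"
    by (rule bij_betw_same_card)
  moreover have "card (\<Union>C\<in>?S. labelings (?A \<union> ?B) p C) = (\<Sum>C\<in>?S. card (labelings (?A \<union> ?B) p C))"
    by (rule card_UN_disjoint) (use finite_cSh[OF \<pi> \<sigma> disj] finite_labelings dis in auto)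
  ultimately show ?thesis by (simp add: card_cartesian_product)
qed

section \<open>Counting the labelings of a cyclic permutation\<close>

definition des :: "nat list \<Rightarrow> nat" where
  "des \<pi> = (\<Sum>i<length \<pi> - 1. of_bool (\<pi> ! Suc i < \<pi> ! i))"

lemma des_snoc:
  assumes "\<pi> \<noteq> []"
  shows "des (\<pi> @ [b]) = des \<pi> + of_bool (b < last \<pi>)"
proof -
  obtain n where n: "length \<pi> = Suc n" using assms by (cases \<pi>) auto
  show ?thesis using assms by (simp add: des_def n nth_append last_conv_nth)
qed

lemma des_less: "\<pi> \<noteq> [] \<Longrightarrow> des \<pi> < length \<pi>"
proof -
  assume "\<pi> \<noteq> []"
  have "des \<pi> \<le> (\<Sum>i<length \<pi> - 1. 1)" unfolding des_def by (rule sum_mono) auto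
  with \<open>\<pi> \<noteq> []\<close> show ?thesis by (cases \<pi>) auto
qed

lemma cdes_lin_eq_des:
  assumes "\<pi> \<noteq> []"
  shows "cdes_lin \<pi> = des \<pi> + of_bool (hd \<pi> < last \<pi>)"
proof -
  obtain n where n: "length \<pi> = Suc n" using assms by (cases \<pi>) auto
  have "cdes_lin \<pi> = (\<Sum>i<Suc n. of_bool (\<pi> ! (Suc i mod Suc n) < \<pi> ! i))"
    by (simp add: cdes_lin_def n lessThan_def of_bool_def sum.If_cases Collect_conj_eq flip: Suc_eq_plus1)
  then show ?thesis using assms by (simp add: des_def n hd_conv_nth last_conv_nth)
qed

lemma arranges_last:
  assumes "arranges h \<pi>" "a \<in> set \<pi>"
  shows "key_less h a (last \<pi>) \<or> a = last \<pi>"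
proof -
  have *: "\<pi> = butlast \<pi> @ [last \<pi>]" using assms(2) by (cases \<pi>) simp_all
  show ?thesis using assms by (subst (asm) (1 2) *) (auto simp: sorted_wrt_append)
qed

lemma arranges_snoc:
  assumes "\<pi> \<noteq> []"
  shows "arranges h (\<pi> @ [b]) \<longleftrightarrow> arranges h \<pi> \<and> key_less h (last \<pi>) b"
  using assms arranges_last[of h \<pi>] by (auto simp: sorted_wrt_append intro: key_less_trans)

text \<open>
  In an arranged list the keys increase weakly, and strictly at each descent; with \<open>d\<close> descents
  the number of such key sequences below \<open>p\<close> is that of weakly increasing sequences below
  \<open>p - d\<close>. Both sides satisfy the same Pascal recursion, obtained by asking whether the last letter
  \<open>b\<close> takes the largest admissible value: if it does, the earlier keys are bounded by that value,
  strictly so when \<open>b\<close> is preceded by a larger letter.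
\<close>
lemma card_linear_labelings:
  assumes "\<pi> \<noteq> []" "distinct \<pi>"
  shows "card {h \<in> set \<pi> \<rightarrow>\<^sub>E {..<p}. arranges h \<pi>} = (p + length \<pi> - 1 - des \<pi>) choose length \<pi>"
  using assms
proof (induction \<pi> arbitrary: p rule: rev_nonempty_induct)
  case (single a)
  have "card ({a} \<rightarrow>\<^sub>E {..<p}) = p" by (simp add: card_PiE)
  then show ?case by (simp add: des_def)
next
  case (snoc b \<pi>)
  let ?N = "\<lambda>\<pi> p. {h \<in> set \<pi> \<rightarrow>\<^sub>E {..<p}. arranges h \<pi>}"
  have b: "b \<notin> set \<pi>" "distinct \<pi>" using snoc.prems by auto
  have lt: "des \<pi> < length \<pi>" using des_less snoc.hyps by blast
  have last: "last \<pi> \<in> set \<pi>" "last \<pi> \<noteq> b" using snoc.hyps b by auto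
  let ?q = "\<lambda>p. if b < last \<pi> then p else Suc p"
  have fin: "finite (?N \<pi> p)" for \<pi> p
    by (rule finite_subset[of _ "set \<pi> \<rightarrow>\<^sub>E {..<p}"]) (auto intro: finite_PiE)
  have step: "card (?N (\<pi> @ [b]) (Suc p)) = card (?N (\<pi> @ [b]) p) + card (?N \<pi> (?q p))" for p
  proof -
    have le_last: "h a \<le> h (last \<pi>)" if "arranges h \<pi>" "a \<in> set \<pi>" for h a
      using arranges_last[OF that] by (auto simp: key_less_def)
    have bd: "arranges h (\<pi> @ [b]) \<longleftrightarrow> arranges h \<pi> \<and> (\<forall>a\<in>set \<pi>. h a < ?q (h b))" for h
      using arranges_snoc[OF snoc.hyps(1), of h b] le_last[of h] last
      by (auto simp: key_less_def less_Suc_eq_le intro: le_less_trans order.trans[OF _ less_imp_le])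
    let ?T = "{h \<in> ?N (\<pi> @ [b]) (Suc p). h b = p}"
    have un: "?N (\<pi> @ [b]) (Suc p) = ?N (\<pi> @ [b]) p \<union> ?T"
    proof (intro equalityI subsetI)
      fix h assume h: "h \<in> ?N (\<pi> @ [b]) (Suc p)"
      show "h \<in> ?N (\<pi> @ [b]) p \<union> ?T"
      proof (cases "h b = p")
        case False
        then have "h b < p" using h by (auto simp: PiE_def Pi_def less_Suc_eq)
        moreover have "h a < p" if "a \<in> set \<pi>" for a
          using h bd[of h] that \<open>h b < p\<close> by (auto split: if_splits dest!: bspec[of _ _ a])
        ultimately show ?thesis using h by (auto simp: PiE_def Pi_def)
      qed (use h in auto)
    qed (auto simp: PiE_def Pi_def less_Suc_eq)
    have dis: "?N (\<pi> @ [b]) p \<inter> ?T = {}" by (auto simp: PiE_def Pi_def)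
    have finT: "finite ?T" by (rule finite_subset[OF _ fin[of "\<pi> @ [b]" "Suc p"]]) blast
    have "card (?N (\<pi> @ [b]) (Suc p)) = card (?N (\<pi> @ [b]) p) + card ?T"
      by (subst un) (rule card_Un_disjoint[OF fin finT dis])
    moreover have "bij_betw (\<lambda>h. restrict h (set \<pi>)) ?T (?N \<pi> (?q p))"
    proof (rule bij_betw_byWitness[where f' = "\<lambda>h. h(b := p)"])
      have c: "arranges (restrict h (set \<pi>)) \<pi> = arranges h \<pi>"
          "arranges (h(b := p)) \<pi> = arranges h \<pi>" for h
        using b by (auto intro!: arranges_cong)
      show "\<forall>h\<in>?T. (restrict h (set \<pi>))(b := p) = h"
        by (auto simp: fun_eq_iff PiE_def extensional_def)
      show "\<forall>h\<in>?N \<pi> (?q p). restrict (h(b := p)) (set \<pi>) = h"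
        using b by (auto simp: fun_eq_iff PiE_def extensional_def)
      show "(\<lambda>h. restrict h (set \<pi>)) ` ?T \<subseteq> ?N \<pi> (?q p)"
        using bd c by (auto simp: PiE_def Pi_def)
      show "(\<lambda>h. h(b := p)) ` ?N \<pi> (?q p) \<subseteq> ?T"
      proof (rule image_subsetI)
        fix h assume "h \<in> ?N \<pi> (?q p)"
        then have h: "h \<in> set \<pi> \<rightarrow>\<^sub>E {..<?q p}" "arranges h \<pi>" by simp_all
        have "arranges (h(b := p)) (\<pi> @ [b])"
          unfolding bd c using h b by (auto simp: PiE_def Pi_def)
        moreover have "h(b := p) \<in> set (\<pi> @ [b]) \<rightarrow>\<^sub>E {..<Suc p}"
          using h b by (auto simp: PiE_def Pi_def extensional_def split: if_splits)
        ultimately show "h(b := p) \<in> ?T"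
          by simp
      qed
    qed
    ultimately show ?thesis by (simp add: bij_betw_same_card)
  qed
  show ?case
  proof (induction p)
    case 0
    have "set (\<pi> @ [b]) \<rightarrow>\<^sub>E {..<0::nat} = {}" by (auto simp: PiE_eq_empty_iff)
    then have N0: "?N (\<pi> @ [b]) 0 = {}" by blast
    have "0 + length (\<pi> @ [b]) - 1 - des (\<pi> @ [b]) < length (\<pi> @ [b])" by simp
    then show ?case by (simp only: N0 card.empty binomial_eq_0)
  next
    case (Suc p)
    have m: "Suc p + length (\<pi> @ [b]) - 1 - des (\<pi> @ [b]) = Suc (p + length (\<pi> @ [b]) - 1 - des (\<pi> @ [b]))"
      using des_less[of "\<pi> @ [b]"] by simp
    have "?q p + length \<pi> - 1 - des \<pi> = p + length (\<pi> @ [b]) - 1 - des (\<pi> @ [b])"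
      using lt snoc.hyps by (simp add: des_snoc)
    then show ?case
      unfolding step Suc snoc.IH[OF b(2)] m by simp
  qed
qed

text \<open>The smallest letter is never the top of a cyclic descent; the largest of at least two letters
  always is.\<close>
lemma cdes_lin_less:
  assumes "\<pi> \<noteq> []"
  shows "cdes_lin \<pi> < length \<pi>"
proof -
  obtain i where i: "i < length \<pi>" "\<pi> ! i = Min (set \<pi>)"
    using Min_in[of "set \<pi>"] assms by (metis List.finite_set in_set_conv_nth set_empty)
  have "\<not> \<pi> ! (Suc i mod length \<pi>) < \<pi> ! i"
    unfolding i(2) not_less using assms by (intro Min_le) simp_all
  then have "i \<notin> {i. i < length \<pi> \<and> \<pi> ! (Suc i mod length \<pi>) < \<pi> ! i}" by blast
  with i(1) have "{i. i < length \<pi> \<and> \<pi> ! (Suc i mod length \<pi>) < \<pi> ! i} \<subset> {..<length \<pi>}"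
    by blast
  then show ?thesis
    unfolding cdes_lin_def by (metis card_lessThan finite_lessThan psubset_card_mono)
qed

lemma cdes_lin_pos:
  assumes "distinct \<pi>" "length \<pi> \<ge> 2"
  shows "cdes_lin \<pi> > 0"
proof -
  have ne: "set \<pi> \<noteq> {}" using assms by auto
  then obtain i where i: "i < length \<pi>" "\<pi> ! i = Max (set \<pi>)"
    using Max_in[of "set \<pi>"] by (metis List.finite_set in_set_conv_nth)
  let ?j = "Suc i mod length \<pi>"
  have j: "?j < length \<pi>" "?j \<noteq> i" using assms i by (auto simp: mod_Suc)
  then have "\<pi> ! ?j \<noteq> \<pi> ! i" using nth_eq_iff_index_eq[OF assms(1) j(1) i(1)] by blast
  moreover have "\<pi> ! ?j \<le> \<pi> ! i" using i j by simp
  ultimately have "i \<in> {i. i < length \<pi> \<and> \<pi> ! (Suc i mod length \<pi>) < \<pi> ! i}"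
    using i by simp
  then show ?thesis unfolding cdes_lin_def by (auto simp: card_gt_0_iff)
qed

lemma cyc_eq_image:
  assumes "\<pi> \<noteq> []"
  shows "cyc \<pi> = (\<lambda>j. rotate j \<pi>) ` {..<length \<pi>}"
proof -
  have "rotate k \<pi> \<in> (\<lambda>j. rotate j \<pi>) ` {..<length \<pi>}" for k
    using assms by (intro image_eqI[of _ _ "k mod length \<pi>"]) (auto simp: rotate_conv_mod[of k])
  then show ?thesis by (auto simp: cyc_def)
qed

text \<open>
  With \<open>M = p + n - k - 1\<close>, Pascal's rule turns the left side into
  \<open>k * (M choose (n - 1)) + n * (M choose n)\<close>, and absorption gives
  \<open>n * (M choose n) = (M - n + 1) * (M choose (n - 1))\<close>, where \<open>k + (M - n + 1) = p\<close>. If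
  \<open>p < k\<close>, the truncated difference \<open>M - (n - 1)\<close> is 0, but then all binomials vanish.
\<close>
lemma binomial_cyclic_sum:
  assumes "k < n"
  shows "k * ((p + n - k) choose n) + (n - k) * ((p + n - k - 1) choose n) =
    p * ((p + n - k - 1) choose (n - 1))"
proof -
  obtain m where m: "n = Suc m" using assms by (cases n) auto
  define M where "M = p + m - k"
  have e: "p + n - k = Suc M" "p + n - k - 1 = M" using assms m by (auto simp: M_def)
  have absorb: "Suc m * (M choose Suc m) = (M - m) * (M choose m)"
  proof (cases M)
    case (Suc L)
    then show ?thesis by (metis Suc_times_binomial binomial_absorb_comp diff_Suc_1 mult.commute)
  qed simp
  have "k * (Suc M choose n) + (n - k) * (M choose n) = k * (M choose m) + Suc m * (M choose Suc m)"
  proof -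
    have "k * (M choose Suc m) + (Suc m - k) * (M choose Suc m) = Suc m * (M choose Suc m)"
      using assms m by (simp flip: add_mult_distrib)
    then show ?thesis by (simp add: m distrib_left)
  qed
  also have "\<dots> = (k + (M - m)) * (M choose m)"
    unfolding absorb by (simp add: distrib_right)
  also have "\<dots> = p * (M choose m)"
    using assms m by (cases "k \<le> p") (auto simp: M_def binomial_eq_0)
  finally show ?thesis unfolding e by (simp add: m)
qed

text \<open>
  Every labeling counted arranges the letters as exactly one of the \<open>n\<close> distinct rotations. The
  rotation cut between positions \<open>j\<close> and \<open>j + 1\<close> has one linear descent less than there are cyclic
  ones if there is a cyclic descent at \<open>j\<close>, and equally many otherwise.
\<close>
lemma card_cyclic_labelings:
  assumes ne: "\<pi> \<noteq> []" and dist: "distinct \<pi>"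
  shows "card (labelings (set \<pi>) p (cyc \<pi>)) =
    p * ((p + length \<pi> - cdes_lin \<pi> - 1) choose (length \<pi> - 1))"
proof -
  let ?n = "length \<pi>" and ?k = "cdes_lin \<pi>"
  let ?L = "\<lambda>\<rho>. {h \<in> set \<rho> \<rightarrow>\<^sub>E {..<p}. arranges h \<rho>}"
  let ?D = "{j. j < ?n \<and> \<pi> ! (Suc j mod ?n) < \<pi> ! j}"
  have n: "?n > 0" using ne by simp
  have hd: "hd (rotate j \<pi>) = \<pi> ! (j mod ?n)" for j using hd_rotate_conv_nth[OF ne] .
  have last: "last (rotate (Suc j) \<pi>) = \<pi> ! j" if "j < ?n" for j
    using ne that hd[of j] by (cases "rotate j \<pi>") auto
  have "labelings (set \<pi>) p (cyc \<pi>) = (\<Union>j<?n. ?L (rotate j \<pi>))"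
    by (auto simp: labelings_def cyc_eq_image[OF ne])
  moreover have "?L (rotate i \<pi>) \<inter> ?L (rotate j \<pi>) = {}" if "i < ?n" "j < ?n" "i \<noteq> j" for i j
  proof -
    have "rotate i \<pi> \<noteq> rotate j \<pi>"
      using hd[of i] hd[of j] that dist by (metis mod_less nth_eq_iff_index_eq)
    then show ?thesis using arrangement_unique by fastforce
  qed
  moreover have "finite (?L \<rho>)" for \<rho>
    by (rule finite_subset[of _ "set \<rho> \<rightarrow>\<^sub>E {..<p}"]) (auto intro: finite_PiE)
  ultimately have "card (labelings (set \<pi>) p (cyc \<pi>)) = (\<Sum>j<?n. card (?L (rotate j \<pi>)))"
    by (simp del: set_rotate add: card_UN_disjoint)
  also have "\<dots> = (\<Sum>j<?n. (p + ?n - 1 - des (rotate j \<pi>)) choose ?n)"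
    using ne dist card_linear_labelings[of "rotate _ \<pi>" p] by simp
  \<comment> \<open>Shifting the index puts the cut of the \<open>j\<close>th rotation directly after position \<open>j\<close>.\<close>
  also have "\<dots> = (\<Sum>j<?n. (p + ?n - 1 - des (rotate (Suc j) \<pi>)) choose ?n)"
    using sum.lessThan_Suc_shift[of "\<lambda>j. (p + ?n - 1 - des (rotate j \<pi>)) choose ?n" ?n] by simp
  also have "\<dots> = (\<Sum>j<?n. if j \<in> ?D then (p + ?n - ?k) choose ?n else (p + ?n - ?k - 1) choose ?n)"
  proof (rule sum.cong)
    fix j assume j: "j \<in> {..<?n}"
    have "?k = des (rotate (Suc j) \<pi>) + of_bool (j \<in> ?D)"
      using cdes_lin_eq_des[of "rotate (Suc j) \<pi>"] j ne hd[of "Suc j"] last[of j]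
      by (simp add: cdes_lin_rotate del: rotate_Suc)
    then show "(p + ?n - 1 - des (rotate (Suc j) \<pi>)) choose ?n =
        (if j \<in> ?D then (p + ?n - ?k) choose ?n else (p + ?n - ?k - 1) choose ?n)"
      by (simp add: diff_diff_add add.commute)
  qed simp
  also have "\<dots> = card ({..<?n} \<inter> ?D) * ((p + ?n - ?k) choose ?n)
      + card ({..<?n} \<inter> - ?D) * ((p + ?n - ?k - 1) choose ?n)"
    by (subst sum.If_cases) simp_all
  also have "card ({..<?n} \<inter> ?D) = ?k" by (simp add: cdes_lin_def Int_def)
  also have "card ({..<?n} \<inter> - ?D) = ?n - ?k"
    using card_Diff_subset[of ?D "{..<?n}"] by (auto simp: cdes_lin_def Diff_eq)
  finally show ?thesis using binomial_cyclic_sum[OF cdes_lin_less[OF ne], of p] by simp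
qed

section \<open>Realizing the cyclic shuffle algebra of a statistic\<close>

lemma cls_eq: "C \<in> cperms \<Longrightarrow> cls cst C = {D \<in> cperms. clen D = clen C \<and> cst D = cst C}"
  by (auto simp: cls_def cyc_rel_def)

lemma quotient_cyc_rel: "cperms // cyc_rel cst = cls cst ` cperms"
  by (auto simp: quotient_def cls_def)

lemma cyc_in_cperms: "lperm \<pi> \<Longrightarrow> cyc \<pi> \<in> cperms"
  by (auto simp: cperms_def)

lemma lookup_cyc_scale [simp]: "Poly_Mapping.lookup (cyc_scale q u) c = q * Poly_Mapping.lookup u c"
  by (simp add: cyc_scale_def Poly_Mapping.map.rep_eq when_def)

global_interpretation cyc: vector_space cyc_scale
  by unfold_locales (auto intro!: poly_mapping_eqI simp: lookup_add algebra_simps)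

text \<open>
  Adding a large constant to all letters of the second permutation makes it disjoint from the first
  and keeps the relative order.
\<close>
lemma ex_disjoint_representatives:
  assumes "cyc_statistic cst" "c \<in> cperms // cyc_rel cst" "d \<in> cperms // cyc_rel cst"
  shows "\<exists>\<pi> \<sigma>. lperm \<pi> \<and> lperm \<sigma> \<and> ldisjoint \<pi> \<sigma> \<and> c = cls cst (cyc \<pi>) \<and> d = cls cst (cyc \<sigma>)"
proof -
  obtain \<pi> \<sigma> where p: "lperm \<pi>" "c = cls cst (cyc \<pi>)" and s: "lperm \<sigma>" "d = cls cst (cyc \<sigma>)"
    using assms(2,3) by (auto simp: quotient_cyc_rel) (auto simp: cperms_def)
  define \<sigma>' where "\<sigma>' = map (\<lambda>a. a + sum_list \<pi>) \<sigma>"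
  have s': "lperm \<sigma>'" using s(1) by (auto simp: lperm_def \<sigma>'_def distinct_map inj_on_def)
  have "ldisjoint \<pi> \<sigma>'"
    using s(1) member_le_sum_list[of _ \<pi>] by (fastforce simp: ldisjoint_def \<sigma>'_def lperm_def)
  moreover have "std \<sigma>' = std \<sigma>"
  proof -
    have "{b \<in> set \<sigma>'. b \<le> a + sum_list \<pi>} = (\<lambda>a. a + sum_list \<pi>) ` {b \<in> set \<sigma>. b \<le> a}" for a
      by (auto simp: \<sigma>'_def)
    then have "card {b \<in> set \<sigma>'. b \<le> a + sum_list \<pi>} = card {b \<in> set \<sigma>. b \<le> a}" for a
      by (simp add: card_image inj_on_def)
    then show ?thesis by (simp add: std_def[of \<sigma>] std_def[of \<sigma>']) (simp add: \<sigma>'_def)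
  qed
  then have "cls cst (cyc \<sigma>') = cls cst (cyc \<sigma>)"
    using assms(1) s(1) s' cls_eq_iff[of "cyc \<sigma>'" "cyc \<sigma>" cst]
    unfolding cyc_statistic_def by (metis cyc_in_cperms clen_cyc length_map \<sigma>'_def)
  ultimately show ?thesis using p s s' by metis
qed

lemma rat_algebra_subalgebra:
  assumes "rat_subalgebra B A"
  shows "rat_algebra (A\<lparr>qcarrier := B\<rparr>)"
  using assms unfolding rat_subalgebra_def rat_algebra_def by (simp add: subset_iff)

text \<open>
  A realization assigns to each pair of a length and a value of the statistic an element of an
  algebra, so that products expand over cyclic shuffles and the elements of the pairs that occur are
  linearly independent. Independence is stated for families indexed by pairs, which includes that
  distinct pairs have distinct elements.
\<close>
locale cyc_realization =
  fixes cst :: "nat list set \<Rightarrow> 'v" and A :: "'b::ab_group_add qalg" and G :: "nat \<times> 'v \<Rightarrow> 'b"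
  assumes stat: "cyc_statistic cst"
    and alg: "rat_algebra A" and carrier: "qcarrier A = UNIV"
    and one: "G (0, cst (cyc [])) = qone A"
    and mult: "\<And>\<pi> \<sigma>. lperm \<pi> \<Longrightarrow> lperm \<sigma> \<Longrightarrow> ldisjoint \<pi> \<sigma> \<Longrightarrow>
      qmult A (G (length \<pi>, cst (cyc \<pi>))) (G (length \<sigma>, cst (cyc \<sigma>))) =
      (\<Sum>C\<in>cSh (cyc \<pi>) (cyc \<sigma>). G (clen C, cst C))"
    and indep: "\<And>X a x. finite X \<Longrightarrow> X \<subseteq> (\<lambda>C. (clen C, cst C)) ` cperms \<Longrightarrow>
      (\<Sum>x\<in>X. qscale A (a x) (G x)) = 0 \<Longrightarrow> x \<in> X \<Longrightarrow> a x = 0"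
begin

abbreviation ix :: "nat list set \<Rightarrow> nat \<times> 'v" where
  "ix C \<equiv> (clen C, cst C)"

interpretation T: vector_space "qscale A"
  using alg by (simp add: rat_algebra_def)

text \<open>
  All cyclic shuffles of two permutations have the same length \<open>N\<close>, so the product of the two
  elements is a combination of the elements for \<open>(N, v)\<close>, in which \<open>v\<close> has its multiplicity among the
  statistics of the shuffles as coefficient. The product depends only on the classes of the factors,
  and the coefficients are unique by independence.
\<close>
lemma shuffle_compatible: "cyc_shuffle_compatible cst"
  unfolding cyc_shuffle_compatible_def
proof (intro conjI stat allI impI, elim conjE)
  fix \<pi> \<sigma> \<pi>' \<sigma>' :: "nat list"
  assume lp: "lperm \<pi>" "lperm \<sigma>" "ldisjoint \<pi> \<sigma>" "lperm \<pi>'" "lperm \<sigma>'" "ldisjoint \<pi>' \<sigma>'"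
    and eqs: "cst (cyc \<pi>) = cst (cyc \<pi>')" "cst (cyc \<sigma>) = cst (cyc \<sigma>')"
      "length \<pi> = length \<pi>'" "length \<sigma> = length \<sigma>'"
  let ?S = "cSh (cyc \<pi>) (cyc \<sigma>)" and ?S' = "cSh (cyc \<pi>') (cyc \<sigma>')"
  define N where "N = length \<pi> + length \<sigma>"
  define V where "V = cst ` ?S \<union> cst ` ?S'"
  have fin: "finite ?S" "finite ?S'" by (intro finite_cSh lp)+
  have expand: "(\<Sum>C\<in>S. G (ix C)) = (\<Sum>v\<in>V. qscale A (of_nat (card {C \<in> S. cst C = v})) (G (N, v)))"
    if S: "finite S" "cst ` S \<subseteq> V" "\<And>C. C \<in> S \<Longrightarrow> clen C = N" for S
  proof -
    have "(\<Sum>C\<in>S. G (ix C)) = (\<Sum>C\<in>S. G (N, cst C))" using S(3) by simp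
    also have "\<dots> = (\<Sum>v\<in>V. \<Sum>C | C \<in> S \<and> cst C = v. G (N, cst C))"
      by (rule sum.group[symmetric]) (use S fin in \<open>auto simp: V_def\<close>)
    also have "\<dots> = (\<Sum>v\<in>V. \<Sum>C | C \<in> S \<and> cst C = v. G (N, v))"
      by (intro sum.cong) auto
    finally show ?thesis by (simp add: T.sum_constant_scale)
  qed
  have "(\<Sum>C\<in>?S. G (ix C)) = (\<Sum>C\<in>?S'. G (ix C))"
    using mult[OF lp(1-3)] mult[OF lp(4-6)] eqs by simp
  moreover have "(\<Sum>C\<in>?S. G (ix C)) =
      (\<Sum>v\<in>V. qscale A (of_nat (card {C \<in> ?S. cst C = v})) (G (N, v)))"
    by (rule expand) (use fin cSh_D in \<open>auto simp: V_def N_def\<close>)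
  moreover have "(\<Sum>C\<in>?S'. G (ix C)) =
      (\<Sum>v\<in>V. qscale A (of_nat (card {C \<in> ?S'. cst C = v})) (G (N, v)))"
    by (rule expand) (use fin cSh_D eqs in \<open>auto simp: V_def N_def\<close>)
  ultimately have "(\<Sum>v\<in>V. qscale A (of_nat (card {C \<in> ?S. cst C = v})
      - of_nat (card {C \<in> ?S'. cst C = v})) (G (N, v))) = 0"
    by (simp add: T.scale_left_diff_distrib sum_subtractf)
  then have *: "(\<Sum>x\<in>Pair N ` V. qscale A (of_nat (card {C \<in> ?S. cst C = snd x})
      - of_nat (card {C \<in> ?S'. cst C = snd x})) (G x)) = 0"
    by (simp add: sum.reindex inj_on_def)
  have "Pair N ` V \<subseteq> ix ` cperms"
    using cSh_D[of _ \<pi> \<sigma>] cSh_D[of _ \<pi>' \<sigma>'] eqs by (force simp: V_def N_def)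
  from indep[OF _ this *] have inV: "card {C \<in> ?S. cst C = v} = card {C \<in> ?S'. cst C = v}" if "v \<in> V" for v
    using that fin by (force simp: V_def)
  have "card {C \<in> ?S. cst C = v} = card {C \<in> ?S'. cst C = v}" for v
  proof (cases "v \<in> V")
    case False
    then have "{C \<in> ?S. cst C = v} = {}" "{C \<in> ?S'. cst C = v} = {}" by (auto simp: V_def)
    then show ?thesis by (simp only:)
  qed (rule inV)
  then show "image_mset cst (mset_set ?S) = image_mset cst (mset_set ?S')"
    using fin by (intro multiset_eqI) (simp add: count_image_mset vimage_def Int_def conj_commute)
qed

definition class_index :: "cyc_class \<Rightarrow> nat \<times> 'v" where
  "class_index c = the_elem (ix ` c)"

lemma class_index_cls:
  assumes "C \<in> cperms"
  shows "class_index (cls cst C) = ix C"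
proof -
  have "ix ` cls cst C = {ix C}" using assms by (auto simp: cls_eq)
  then show ?thesis by (simp add: class_index_def)
qed

lemma inj_class_index: "inj_on class_index (cperms // cyc_rel cst)"
  by (auto simp: inj_on_def quotient_cyc_rel class_index_cls cls_eq_iff)

definition realize :: "(cyc_class \<Rightarrow>\<^sub>0 rat) \<Rightarrow> 'b" where
  "realize u = (\<Sum>c\<in>Poly_Mapping.keys u. qscale A (Poly_Mapping.lookup u c) (G (class_index c)))"

lemma realize_superset:
  assumes "finite K" "Poly_Mapping.keys u \<subseteq> K"
  shows "realize u = (\<Sum>c\<in>K. qscale A (Poly_Mapping.lookup u c) (G (class_index c)))"
  unfolding realize_def using assms
  by (intro sum.mono_neutral_left) (auto simp: in_keys_iff)

lemma realize_add: "realize (u + v) = realize u + realize v"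
proof -
  let ?K = "Poly_Mapping.keys u \<union> Poly_Mapping.keys v"
  show ?thesis
    using keys_add[of u v] realize_superset[of ?K u] realize_superset[of ?K v] realize_superset[of ?K "u + v"]
    by (simp add: lookup_add T.scale_left_distrib sum.distrib)
qed

lemma realize_scale: "realize (cyc_scale q u) = qscale A q (realize u)"
proof -
  have "Poly_Mapping.keys (cyc_scale q u) \<subseteq> Poly_Mapping.keys u" by (auto simp: in_keys_iff)
  then show ?thesis
    by (subst realize_superset[of "Poly_Mapping.keys u"])
      (simp_all add: realize_def T.scale_sum_right)
qed

lemma realize_zero: "realize 0 = 0"
  by (simp add: realize_def)

lemma realize_sum: "realize (sum f X) = (\<Sum>x\<in>X. realize (f x))"
  using sum_comp_morphism[of realize f X] by (simp add: realize_add realize_zero o_def)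

lemma realize_bas: "C \<in> cperms \<Longrightarrow> realize (bas cst C) = G (ix C)"
  by (simp add: realize_def bas_def class_index_cls)

lemma realize_one: "realize (bas cst (cyc [])) = qone A"
  using one by (subst realize_bas) (simp_all add: cyc_in_cperms lperm_def clen_cyc)

definition carr :: "(cyc_class \<Rightarrow>\<^sub>0 rat) set" where
  "carr = {u. Poly_Mapping.keys u \<subseteq> cperms // cyc_rel cst}"

lemma subspace_carr: "cyc.subspace carr"
proof (rule cyc.subspaceI)
  fix u v q assume "u \<in> carr" "v \<in> carr"
  then show "u + v \<in> carr" using keys_add[of u v] by (auto simp: carr_def)
  have "Poly_Mapping.keys (cyc_scale q u) \<subseteq> Poly_Mapping.keys u" by (auto simp: in_keys_iff)
  then show "cyc_scale q u \<in> carr" using \<open>u \<in> carr\<close> by (auto simp: carr_def)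
qed (simp add: carr_def)

lemma bas_carr: "C \<in> cperms \<Longrightarrow> bas cst C \<in> carr"
  by (auto simp: bas_def quotient_cyc_rel carr_def)

lemma inj_realize: "inj_on realize carr"
proof (rule inj_onI)
  fix u v assume uv: "u \<in> carr" "v \<in> carr" "realize u = realize v"
  let ?K = "Poly_Mapping.keys u \<union> Poly_Mapping.keys v"
  let ?w = "u - v"
  have inj: "inj_on class_index ?K"
    by (rule inj_on_subset[OF inj_class_index]) (use uv in \<open>auto simp: carr_def\<close>)
  let ?a = "\<lambda>x. Poly_Mapping.lookup ?w (inv_into ?K class_index x)"
  have "(\<Sum>x\<in>class_index ` ?K. qscale A (?a x) (G x)) =
      (\<Sum>c\<in>?K. qscale A (Poly_Mapping.lookup ?w c) (G (class_index c)))"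
    using inj by (simp add: sum.reindex cong: sum.cong) (simp cong: sum.cong add: inv_into_f_f del: Un_iff)
  also have "\<dots> = realize u - realize v"
    using realize_superset[of ?K u] realize_superset[of ?K v]
    by (simp add: lookup_minus T.scale_left_diff_distrib sum_subtractf)
  finally have sum0: "(\<Sum>x\<in>class_index ` ?K. qscale A (?a x) (G x)) = 0" using uv by simp
  have "class_index ` ?K \<subseteq> ix ` cperms"
    using uv by (auto simp: quotient_cyc_rel class_index_cls carr_def dest!: subsetD)
  then have "?a x = 0" if "x \<in> class_index ` ?K" for x
    using indep[OF _ _ sum0 that] by simp
  then have "Poly_Mapping.lookup ?w c = 0" if "c \<in> ?K" for c
    using that inj by (metis image_eqI inv_into_f_f)
  then have "Poly_Mapping.lookup u c = Poly_Mapping.lookup v c" for c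
    by (cases "c \<in> ?K") (auto simp: lookup_minus in_keys_iff)
  then show "u = v" by (rule poly_mapping_eqI)
qed

lemma image_realize: "realize ` carr = T.span (G ` ix ` cperms)"
proof
  show "realize ` carr \<subseteq> T.span (G ` ix ` cperms)"
  proof (rule image_subsetI)
    fix u assume "u \<in> carr"
    then have u: "Poly_Mapping.keys u \<subseteq> cperms // cyc_rel cst" by (simp add: carr_def)
    show "realize u \<in> T.span (G ` ix ` cperms)"
      unfolding realize_def
    proof (intro T.span_sum T.span_scale T.span_base)
      fix c assume "c \<in> Poly_Mapping.keys u"
      then obtain C where "C \<in> cperms" "c = cls cst C" using u by (auto simp: quotient_cyc_rel)
      then show "G (class_index c) \<in> G ` ix ` cperms" by (simp add: class_index_cls)
    qed
  qed
  show "T.span (G ` ix ` cperms) \<subseteq> realize ` carr"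
  proof (rule T.span_minimal)
    show "G ` ix ` cperms \<subseteq> realize ` carr"
      using bas_carr by (auto simp flip: realize_bas)
    show "T.subspace (realize ` carr)"
    proof (rule T.subspaceI)
      show "0 \<in> realize ` carr"
        by (rule image_eqI[of _ _ 0]) (simp_all add: realize_zero carr_def)
    next
      fix x y assume "x \<in> realize ` carr" "y \<in> realize ` carr"
      then obtain u v where "u \<in> carr" "v \<in> carr" "x = realize u" "y = realize v" by blast
      then show "x + y \<in> realize ` carr"
        by (intro image_eqI[of _ _ "u + v"] cyc.subspace_add[OF subspace_carr]) (auto simp: realize_add)
    next
      fix q x assume "x \<in> realize ` carr"
      then obtain u where "u \<in> carr" "x = realize u" by blast
      then show "qscale A q x \<in> realize ` carr"
        by (intro image_eqI[of _ _ "cyc_scale q u"] cyc.subspace_scale[OF subspace_carr])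
          (auto simp: realize_scale)
    qed
  qed
qed

lemma cls_mult_realize:
  assumes "c \<in> cperms // cyc_rel cst" "d \<in> cperms // cyc_rel cst"
  shows "cls_mult cst c d \<in> carr"
    and "realize (cls_mult cst c d) = qmult A (G (class_index c)) (G (class_index d))"
proof -
  obtain \<pi> \<sigma> where lp: "lperm \<pi>" "lperm \<sigma>" "ldisjoint \<pi> \<sigma>"
    and cd: "c = cls cst (cyc \<pi>)" "d = cls cst (cyc \<sigma>)"
    using ex_disjoint_representatives[OF stat assms] by blast
  have eq: "cls_mult cst c d = (\<Sum>C\<in>cSh (cyc \<pi>) (cyc \<sigma>). bas cst C)"
    unfolding cd by (rule cls_mult_eq[OF shuffle_compatible lp])
  show "cls_mult cst c d \<in> carr"
    unfolding eq by (intro cyc.subspace_sum[OF subspace_carr] bas_carr) (rule cSh_D)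
  have "realize (cls_mult cst c d) = (\<Sum>C\<in>cSh (cyc \<pi>) (cyc \<sigma>). G (ix C))"
    unfolding eq realize_sum by (intro sum.cong refl realize_bas) (rule cSh_D)
  then show "realize (cls_mult cst c d) = qmult A (G (class_index c)) (G (class_index d))"
    using lp by (simp add: mult cd class_index_cls cyc_in_cperms clen_cyc)
qed

lemma A_bilinear:
  shows "qmult A (u + v) w = qmult A u w + qmult A v w"
    and "qmult A u (v + w) = qmult A u v + qmult A u w"
    and "qmult A (qscale A q u) v = qscale A q (qmult A u v)"
    and "qmult A u (qscale A q v) = qscale A q (qmult A u v)"
  using alg unfolding rat_algebra_def carrier by simp_all

lemma A_mult_sum:
  shows "qmult A (sum f X) v = (\<Sum>x\<in>X. qmult A (f x) v)"
    and "qmult A u (sum g Y) = (\<Sum>y\<in>Y. qmult A u (g y))"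
proof -
  have "qmult A 0 v = 0" "qmult A u 0 = 0"
    using A_bilinear(3)[of 0 0 v] A_bilinear(4)[of u 0 0] by simp_all
  then show "qmult A (sum f X) v = (\<Sum>x\<in>X. qmult A (f x) v)"
    "qmult A u (sum g Y) = (\<Sum>y\<in>Y. qmult A u (g y))"
    using sum_comp_morphism[of "\<lambda>w. qmult A w v" f X] sum_comp_morphism[of "qmult A u" g Y]
    by (simp_all add: A_bilinear o_def)
qed

lemma cyc_mult_carr: "u \<in> carr \<Longrightarrow> v \<in> carr \<Longrightarrow> cyc_mult cst u v \<in> carr"
  unfolding cyc_mult_def
  by (intro cyc.subspace_sum[OF subspace_carr] cyc.subspace_scale[OF subspace_carr] cls_mult_realize(1))
    (auto simp: carr_def)

lemma realize_mult:
  assumes "u \<in> carr" "v \<in> carr"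
  shows "realize (cyc_mult cst u v) = qmult A (realize u) (realize v)"
proof -
  have "realize (cyc_mult cst u v) = (\<Sum>c\<in>Poly_Mapping.keys u. \<Sum>d\<in>Poly_Mapping.keys v.
      qscale A (Poly_Mapping.lookup u c * Poly_Mapping.lookup v d)
        (qmult A (G (class_index c)) (G (class_index d))))"
    unfolding cyc_mult_def realize_sum realize_scale
    using assms by (intro sum.cong refl) (auto simp: cls_mult_realize(2) subset_iff carr_def)
  then show ?thesis
    by (simp add: realize_def A_mult_sum(1)) (simp add: A_mult_sum(2) A_bilinear T.scale_sum_right mult.commute)
qed

text \<open>
  The laws hold for the images under the injective map \<open>realize\<close>, hence in the cyclic shuffle
  algebra itself.
\<close>
lemma rat_algebra_cyc: "rat_algebra (cyc_algebra cst)"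
proof -
  have A: "qmult A (qmult A x y) z = qmult A x (qmult A y z)"
      "qmult A (qone A) x = x" "qmult A x (qone A) = x" for x y z
    using alg unfolding rat_algebra_def carrier by simp_all
  have eqI: "u = v" if "realize u = realize v" "u \<in> carr" "v \<in> carr" for u v
    using inj_onD[OF inj_realize] that .
  have one_carr: "bas cst (cyc []) \<in> carr"
    by (intro bas_carr cyc_in_cperms) (simp add: lperm_def)
  note simps = realize_mult cyc_mult_carr realize_one realize_add realize_scale A_bilinear
    cyc.subspace_add[OF subspace_carr] cyc.subspace_scale[OF subspace_carr] one_carr A
  show ?thesis
    unfolding rat_algebra_def cyc_algebra_def qalg.simps carr_def[symmetric]
  proof (intro conjI ballI allI cyc.vector_space_axioms subspace_carr one_carr cyc_mult_carr)
    fix u v w q assume "u \<in> carr" "v \<in> carr" "w \<in> carr"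
    then show "cyc_mult cst (cyc_mult cst u v) w = cyc_mult cst u (cyc_mult cst v w)"
      "cyc_mult cst (u + v) w = cyc_mult cst u w + cyc_mult cst v w"
      "cyc_mult cst u (v + w) = cyc_mult cst u v + cyc_mult cst u w"
      by (intro eqI; simp add: simps)+
  next
    fix u assume "u \<in> carr"
    then show "cyc_mult cst (bas cst (cyc [])) u = u" "cyc_mult cst u (bas cst (cyc [])) = u"
      by (intro eqI; simp add: simps)+
  next
    fix q u v assume "u \<in> carr" "v \<in> carr"
    then show "cyc_mult cst (cyc_scale q u) v = cyc_scale q (cyc_mult cst u v)"
      "cyc_mult cst u (cyc_scale q v) = cyc_scale q (cyc_mult cst u v)"
      by (intro eqI; simp add: simps)+
  qed
qed

theorem subalgebra_span: "rat_subalgebra (T.span (G ` ix ` cperms)) A"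
  unfolding rat_subalgebra_def
proof (intro conjI alg T.subspace_span ballI)
  show "qone A \<in> T.span (G ` ix ` cperms)"
    unfolding image_realize[symmetric] realize_one[symmetric]
    by (intro imageI bas_carr cyc_in_cperms) (simp add: lperm_def)
  fix x y assume "x \<in> T.span (G ` ix ` cperms)" "y \<in> T.span (G ` ix ` cperms)"
  then obtain u v where "u \<in> carr" "v \<in> carr" "x = realize u" "y = realize v"
    unfolding image_realize[symmetric] by blast
  then show "qmult A x y \<in> T.span (G ` ix ` cperms)"
    unfolding image_realize[symmetric] by (metis realize_mult cyc_mult_carr imageI)
qed (simp add: carrier)

theorem iso_span:
  "rat_algebra_iso realize (cyc_algebra cst) (A\<lparr>qcarrier := T.span (G ` ix ` cperms)\<rparr>)"
  unfolding rat_algebra_iso_def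
  using rat_algebra_cyc rat_algebra_subalgebra[OF subalgebra_span] inj_realize image_realize
    realize_add realize_scale realize_mult realize_one
  by (simp add: cyc_algebra_def bij_betw_def flip: carr_def)

end

section \<open>The values of the cyclic descent number\<close>

lemma card_atMost_less_iff:
  fixes S :: "nat set"
  assumes "finite S" "x \<in> S" "y \<in> S"
  shows "card {b \<in> S. b \<le> x} < card {b \<in> S. b \<le> y} \<longleftrightarrow> x < y"
proof
  assume *: "card {b \<in> S. b \<le> x} < card {b \<in> S. b \<le> y}"
  show "x < y"
  proof (rule ccontr)
    assume "\<not> x < y"
    then have "card {b \<in> S. b \<le> y} \<le> card {b \<in> S. b \<le> x}"
      using assms by (intro card_mono) auto
    with * show False by simp
  qed
next
  assume xy: "x < y"
  show "card {b \<in> S. b \<le> x} < card {b \<in> S. b \<le> y}"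
  proof (rule psubset_card_mono)
    have "y \<in> {b \<in> S. b \<le> y}" "y \<notin> {b \<in> S. b \<le> x}" using assms xy by auto
    then show "{b \<in> S. b \<le> x} \<subset> {b \<in> S. b \<le> y}" using xy by force
  qed (use assms in simp)
qed

lemma cdes_lin_std: "cdes_lin (std \<pi>) = cdes_lin \<pi>"
proof -
  have "std \<pi> ! i > std \<pi> ! (Suc i mod length \<pi>) \<longleftrightarrow> \<pi> ! i > \<pi> ! (Suc i mod length \<pi>)"
    if "i < length \<pi>" for i
  proof -
    have "Suc i mod length \<pi> < length \<pi>" using that by (intro mod_less_divisor) linarith
    then show ?thesis using that by (simp add: std_def card_atMost_less_iff)
  qed
  then have "{i. i < length \<pi> \<and> std \<pi> ! i > std \<pi> ! (Suc i mod length \<pi>)} =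
      {i. i < length \<pi> \<and> \<pi> ! i > \<pi> ! (Suc i mod length \<pi>)}" by blast
  then show ?thesis by (simp add: cdes_lin_def std_def)
qed

lemma cyc_statistic_cdes: "cyc_statistic cdes"
  unfolding cyc_statistic_def cdes_cyc by (metis cdes_lin_std)

lemma des_rev_upt: "des (rev [1..<Suc k]) = k - 1"
proof -
  have "des (rev [1..<Suc k]) = (\<Sum>i<k - 1. 1)"
    unfolding des_def by (rule sum.cong) (auto simp: rev_nth simp del: upt_Suc)
  then show ?thesis by simp
qed

text \<open>
  The witness is \<open>k, k - 1, ..., 1, k + 1, k + 2, ..., n\<close>, with \<open>k - 1\<close> descents
  at the start and one more from \<open>n\<close> back to \<open>k\<close>.
\<close>
lemma ex_lperm_cdes:
  assumes "1 \<le> k" "k < n"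
  shows "\<exists>\<pi>. lperm \<pi> \<and> length \<pi> = n \<and> cdes_lin \<pi> = k"
proof -
  let ?\<pi> = "\<lambda>m. rev [1..<Suc k] @ [Suc k..<Suc m]"
  have ne: "rev [1..<Suc k] \<noteq> []" using assms by simp
  have des: "des (?\<pi> m) = k - 1" if "k \<le> m" for m
    using that
  proof (induction m rule: dec_induct)
    case base
    show ?case using des_rev_upt[of k] by simp
  next
    case (step m)
    have "?\<pi> (Suc m) = ?\<pi> m @ [Suc m]" using step.hyps by simp
    moreover have "last (?\<pi> m) \<in> set (?\<pi> m)" using ne by (intro last_in_set) simp
    then have "last (?\<pi> m) \<le> Suc m" using step.hyps by (auto simp del: upt_Suc)
    ultimately show ?case using step.IH des_snoc[of "?\<pi> m" "Suc m"] ne by simp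
  qed
  have "hd (?\<pi> n) = k" "last (?\<pi> n) = n"
    using assms by simp_all
  then have "cdes_lin (?\<pi> n) = k"
    using cdes_lin_eq_des[of "?\<pi> n"] des[of n] ne assms by simp
  moreover have "lperm (?\<pi> n)" "length (?\<pi> n) = n"
    using assms by (auto simp: lperm_def simp del: upt_Suc)
  ultimately show ?thesis by blast
qed

definition cdes_index :: "(nat \<times> nat) set" where
  "cdes_index = {(0, 0), (1, 0)} \<union> {(n, k) | n k. n \<ge> 2 \<and> 1 \<le> k \<and> k \<le> n - 1}"

lemma cdes_lin_index: 
  assumes "lperm \<pi>"
  shows "(length \<pi>, cdes_lin \<pi>) \<in> cdes_index"
proof -
  consider "\<pi> = []" | "length \<pi> = 1" | "length \<pi> \<ge> 2" by (cases \<pi> rule: remdups_adj.cases) auto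
  then show ?thesis
  proof cases
    case 1 then show ?thesis by (simp add: cdes_index_def cdes_lin_def)
  next
    case 2
    then have "\<pi> \<noteq> []" by auto
    with 2 show ?thesis using cdes_lin_less[of \<pi>] by (simp add: cdes_index_def)
  next
    case 3 
    then have "\<pi> \<noteq> []" by auto
    with 3 show ?thesis using cdes_lin_less[of \<pi>] cdes_lin_pos[of \<pi>] assms
      by (auto simp: cdes_index_def lperm_def)
  qed
qed

lemma image_cdes_index: "(\<lambda>C. (clen C, cdes C)) ` cperms = cdes_index"
proof
  show "(\<lambda>C. (clen C, cdes C)) ` cperms \<subseteq> cdes_index"
    using cdes_lin_index by (auto simp: cperms_def clen_cyc cdes_cyc)
  have "\<exists>\<pi>. lperm \<pi> \<and> x = (length \<pi>, cdes_lin \<pi>)" if x: "x \<in> cdes_index" for x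
  proof -
    consider "x = (0, 0)" | "x = (1, 0)" | n k where "x = (n, k)" "1 \<le> k" "k < n"
      using x by (auto simp: cdes_index_def)
    then show ?thesis
    proof cases
      case 1 then show ?thesis by (intro exI[of _ "[]"]) (simp add: lperm_def cdes_lin_def)
    next
      case 2 then show ?thesis
        using cdes_lin_less[of "[1]"] by (intro exI[of _ "[1]"]) (simp add: lperm_def)
    next
      case 3 then show ?thesis using ex_lperm_cdes[of k n] by blast
    qed
  qed
  then show "cdes_index \<subseteq> (\<lambda>C. (clen C, cdes C)) ` cperms"
    by (force simp: cperms_def clen_cyc cdes_cyc)
qed

section \<open>The realization by functions of \<open>p\<close>\<close>

definition binomial_of :: "nat \<times> nat \<Rightarrow> nat \<Rightarrow> rat poly" where
  "binomial_of = (\<lambda>(n, k). if n = 0 then (\<lambda>p. 1) else cdes_binomial n k)"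

lemma binomial_of_eq_card:
  assumes "lperm \<pi>"
  shows "binomial_of (length \<pi>, cdes_lin \<pi>) p =
    monom (of_nat (card (labelings (set \<pi>) p (cyc \<pi>)))) (length \<pi>)"
proof (cases "\<pi> = []")
  case True
  have "cyc [] = {[]}" by (auto simp: cyc_def)
  then have "labelings {} p (cyc []) = {\<lambda>_. undefined}" by (auto simp: labelings_def)
  then show ?thesis using True by (simp add: binomial_of_def)
next
  case False
  then show ?thesis
    using card_cyclic_labelings[of \<pi> p] assms
    by (simp add: binomial_of_def cdes_binomial_def lperm_def mult.commute)
qed

lemma sum_fun_apply: "(\<Sum>x\<in>X. f x) p = (\<Sum>x\<in>X. f x p)" for f :: "'a \<Rightarrow> 'b \<Rightarrow> 'c::comm_monoid_add"
  by (induction X rule: infinite_finite_induct) simp_all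

lemma binomial_of_mult:
  assumes "lperm \<pi>" "lperm \<sigma>" "ldisjoint \<pi> \<sigma>"
  shows "binomial_of (length \<pi>, cdes (cyc \<pi>)) * binomial_of (length \<sigma>, cdes (cyc \<sigma>)) =
    (\<Sum>C\<in>cSh (cyc \<pi>) (cyc \<sigma>). binomial_of (clen C, cdes C))"
proof
  fix p
  let ?S = "cSh (cyc \<pi>) (cyc \<sigma>)" and ?N = "length \<pi> + length \<sigma>"
  have C: "binomial_of (clen C, cdes C) p =
      monom (of_nat (card (labelings (set \<pi> \<union> set \<sigma>) p C))) ?N" if "C \<in> ?S" for C
  proof -
    obtain \<tau> where t: "lperm \<tau>" "set \<tau> = set \<pi> \<union> set \<sigma>" "C = cyc \<tau>"
      using cSh_representative[OF assms \<open>C \<in> ?S\<close>] by blast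
    have "length \<tau> = ?N" using cSh_D(2)[OF that] t(3) by (simp add: clen_cyc)
    then show ?thesis
      using binomial_of_eq_card[OF t(1), of p] t by (simp add: clen_cyc cdes_cyc)
  qed
  have "(binomial_of (length \<pi>, cdes (cyc \<pi>)) * binomial_of (length \<sigma>, cdes (cyc \<sigma>))) p =
      monom (of_nat (card (labelings (set \<pi>) p (cyc \<pi>)) * card (labelings (set \<sigma>) p (cyc \<sigma>)))) ?N"
    using assms by (simp add: cdes_cyc binomial_of_eq_card mult_monom)
  also have "\<dots> = (\<Sum>C\<in>?S. binomial_of (clen C, cdes C) p)"
    using C by (simp add: card_labelings_mult[OF assms] monom_sum)
  also have "\<dots> = (\<Sum>C\<in>?S. binomial_of (clen C, cdes C)) p"
    by (simp add: sum_fun_apply)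
  finally show "(binomial_of (length \<pi>, cdes (cyc \<pi>)) * binomial_of (length \<sigma>, cdes (cyc \<sigma>))) p =
      (\<Sum>C\<in>?S. binomial_of (clen C, cdes C)) p" .
qed

lemma coeff_binomial_of:
  "coeff (binomial_of (n, k) p) m =
     (if m = n then if n = 0 then 1 else of_nat (((p + n - k - 1) choose (n - 1)) * p) else 0)"
  by (simp add: binomial_of_def cdes_binomial_def)

text \<open>
  Evaluation at \<open>p = k\<close> separates \<open>k\<close> from all larger indices. In lengths 0 and 1 only \<open>k = 0\<close>
  occurs; there the evaluation is at \<open>p = 1\<close> because \<open>p x\<close> vanishes at \<open>p = 0\<close>.
\<close>
lemma coeff_binomial_of_triangular:
  assumes "(n, k) \<in> cdes_index" "(n, l) \<in> cdes_index"
  shows "coeff (binomial_of (n, k) (max 1 k)) n \<noteq> 0"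
    and "k < l \<Longrightarrow> coeff (binomial_of (n, l) (max 1 k)) n = 0"
  using assms by (auto simp: coeff_binomial_of cdes_index_def max_def not_le)

lemma binomial_of_independent:
  assumes X: "finite X" "X \<subseteq> cdes_index" and x: "x \<in> X"
    and zero: "(\<Sum>x\<in>X. (\<lambda>p. smult (a x) (binomial_of x p))) = 0"
  shows "a x = 0"
proof (rule ccontr)
  \<comment> \<open>The coefficients of \<open>x ^ n\<close> isolate one length; take the least \<open>k\<close> of that length whose scalar
    does not vanish, and evaluate at \<open>max 1 k\<close>.\<close>
  obtain n l where nl: "x = (n, l)" by (cases x)
  assume "a x \<noteq> 0"
  then obtain k where k: "(n, k) \<in> X" "a (n, k) \<noteq> 0" and least: "\<And>j. j < k \<Longrightarrow> (n, j) \<in> X \<Longrightarrow> a (n, j) = 0"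
    using x nl exists_least_iff[of "\<lambda>k. (n, k) \<in> X \<and> a (n, k) \<noteq> 0"] by blast
  let ?p = "max 1 k"
  have "a y * coeff (binomial_of y ?p) n = 0" if y: "y \<in> X - {(n, k)}" for y
  proof -
    obtain m j where mj: "y = (m, j)" by (cases y)
    consider "m \<noteq> n" | "m = n" "j < k" | "m = n" "k < j" using y mj by fastforce
    then show ?thesis
    proof cases
      case 3
      then show ?thesis using coeff_binomial_of_triangular(2)[of n k j] y k X mj by auto
    qed (use least y mj in \<open>auto simp: coeff_binomial_of\<close>)
  qed
  then have "(\<Sum>y\<in>X. a y * coeff (binomial_of y ?p) n) = a (n, k) * coeff (binomial_of (n, k) ?p) n"
    by (subst sum.remove[OF X(1) k(1)]) (simp only: sum.neutral[rule_format] add_0_right)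
  moreover have "(\<Sum>y\<in>X. a y * coeff (binomial_of y ?p) n) = 0"
    using fun_cong[OF zero, of ?p] by (simp add: sum_fun_apply coeff_sum poly_eq_iff)
  ultimately show False using k coeff_binomial_of_triangular(1)[of n k k] X by auto
qed

lemma rat_algebra_poly_fun: "rat_algebra poly_fun_algebra"
proof -
  interpret vector_space "\<lambda>q (f :: nat \<Rightarrow> rat poly) p. smult q (f p)"
    by unfold_locales (simp_all add: fun_eq_iff smult_add_right smult_add_left)
  show ?thesis
    unfolding rat_algebra_def poly_fun_algebra_def qalg.simps
    by (intro conjI) (simp_all add: vector_space_axioms fun_eq_iff algebra_simps)
qed

interpretation poly_fun: cyc_realization cdes poly_fun_algebra binomial_of
proof
  show "cyc_statistic cdes" by (rule cyc_statistic_cdes)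
  show "rat_algebra poly_fun_algebra" by (rule rat_algebra_poly_fun)
  show "qcarrier poly_fun_algebra = UNIV" by (simp add: poly_fun_algebra_def)
  show "binomial_of (0, cdes (cyc [])) = qone poly_fun_algebra"
    by (simp add: binomial_of_def poly_fun_algebra_def fun_eq_iff)
qed (use binomial_of_mult binomial_of_independent in \<open>simp_all add: poly_fun_algebra_def image_cdes_index\<close>)

section \<open>The realization by power series in \<open>t\<close>\<close>

text \<open>
  Under the Hadamard product, taking the coefficient of \<open>t ^ p\<close> is multiplicative for each \<open>p\<close>. All
  these maps together embed the ambient algebra of part (b) into that of part (c), so that laws, products and
  independence carry over from the functions of \<open>p\<close>.
\<close>
definition coefficientwise :: "rat hfps poly \<Rightarrow> nat \<Rightarrow> rat poly" where
  "coefficientwise P p = map_poly (\<lambda>f. fps_nth (fps_of_hfps f) p) P"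

lemma coeff_coefficientwise: "coeff (coefficientwise P p) n = fps_nth (fps_of_hfps (coeff P n)) p"
  by (simp add: coefficientwise_def coeff_map_poly zero_hfps.rep_eq)

lemma coefficientwise_inject: "coefficientwise P = coefficientwise Q \<longleftrightarrow> P = Q"
proof
  assume "coefficientwise P = coefficientwise Q"
  then have "fps_nth (fps_of_hfps (coeff P n)) p = fps_nth (fps_of_hfps (coeff Q n)) p" for n p
    by (metis coeff_coefficientwise)
  then have "coeff P n = coeff Q n" for n by (simp add: fps_eq_iff flip: fps_of_hfps_inject)
  then show "P = Q" by (rule poly_eqI)
qed simp

lemma nth_fps_of_hfps_sum: "fps_nth (fps_of_hfps (sum f X)) p = (\<Sum>x\<in>X. fps_nth (fps_of_hfps (f x)) p)"
  by (induction X rule: infinite_finite_induct) (simp_all add: zero_hfps.rep_eq plus_hfps.rep_eq)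

abbreviation hadamard_scale :: "rat \<Rightarrow> rat hfps poly \<Rightarrow> rat hfps poly" where
  "hadamard_scale q \<equiv> map_poly (hfps_scale q)"

lemma coeff_hadamard_scale: "coeff (hadamard_scale q P) n = hfps_scale q (coeff P n)"
  by (rule coeff_map_poly) (transfer, simp)

lemma coefficientwise_simps:
  "coefficientwise 0 = 0" "coefficientwise 1 = 1"
  "coefficientwise (P + Q) = coefficientwise P + coefficientwise Q"
  "coefficientwise (P * Q) = coefficientwise P * coefficientwise Q"
  "coefficientwise (hadamard_scale q P) = (\<lambda>p. smult q (coefficientwise P p))"
  by (simp_all add: fun_eq_iff poly_eq_iff coeff_coefficientwise coeff_mult nth_fps_of_hfps_sum
      coeff_hadamard_scale coeff_1 one_hfps.rep_eq zero_hfps.rep_eq plus_hfps.rep_eq times_hfps.rep_eq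
      hfps_scale.rep_eq)

lemma coefficientwise_sum: "coefficientwise (sum f X) = (\<Sum>x\<in>X. coefficientwise (f x))"
  using sum_comp_morphism[of coefficientwise f X] by (simp add: coefficientwise_simps o_def)

lemma rat_algebra_hadamard: "rat_algebra hadamard_algebra"
proof -
  note inj = coefficientwise_inject[symmetric] coefficientwise_simps
  interpret vector_space hadamard_scale
    by unfold_locales (simp_all only: inj, simp_all add: fun_eq_iff smult_add_right smult_add_left)
  have "hadamard_scale q P * Q = hadamard_scale q (P * Q)" "P * hadamard_scale q Q = hadamard_scale q (P * Q)"
    for q P Q by (simp_all only: inj, simp_all add: fun_eq_iff)
  then show ?thesis
    unfolding rat_algebra_def hadamard_algebra_def qalg.simps
    by (intro conjI) (simp_all add: vector_space_axioms algebra_simps)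
qed

definition series_of :: "nat \<times> nat \<Rightarrow> rat hfps poly" where
  "series_of = (\<lambda>(n, k). if n = 0 then monom (hfps (1 / (1 - fps_X))) 0 else cdes_series n k)"

text \<open>
  The series expands to the sum over rotations that counts the labelings, since
  \<open>1 / (1 - t) ^ (n + 1)\<close> has coefficients \<open>(n + j) choose n\<close>.
\<close>
lemma nth_cdes_series:
  assumes "k < n"
  shows "fps_nth ((of_nat k * fps_X ^ k + (of_nat n - of_nat k) * fps_X ^ (k + 1)) / (1 - fps_X) ^ (n + 1)) p
    = (of_nat (((p + n - k - 1) choose (n - 1)) * p) :: rat)"
proof -
  define D :: "rat fps" where "D = inverse ((1 - fps_X) ^ (n + 1))"
  have D: "fps_nth D j = of_nat ((n + j) choose n)" for j
    using one_minus_const_fps_X_neg_power'[of "n + 1" "1 :: rat"] binomial_symmetric[of n "n + j"]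
    by (simp add: D_def)
  have "(of_nat k * fps_X ^ k + (of_nat n - of_nat k) * fps_X ^ (k + 1)) / (1 - fps_X) ^ (n + 1)
      = fps_const (of_nat k) * (fps_X ^ k * D) + fps_const (of_nat (n - k)) * (fps_X ^ (k + 1) * D)"
    using assms by (simp add: fps_divide_unit D_def algebra_simps of_nat_diff fps_of_nat[symmetric]
      flip: fps_const_sub)
  also have "fps_nth \<dots> p = of_nat (k * ((p + n - k) choose n) + (n - k) * ((p + n - k - 1) choose n))"
  proof -
    consider "p < k" | "p = k" | "p > k" by linarith
    then show ?thesis
      using assms by cases
        (auto simp: fps_X_power_mult_nth D binomial_eq_0 add.commute[of n] simp del: power_Suc)
  qed
  finally show ?thesis by (simp only: binomial_cyclic_sum[OF assms] mult.commute)
qed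

lemma coefficientwise_series:
  assumes "x \<in> cdes_index"
  shows "coefficientwise (series_of x) = binomial_of x"
proof -
  obtain n k where x: "x = (n, k)" by (cases x)
  have k: "k < n \<or> n = 0" using assms x by (auto simp: cdes_index_def)
  have one: "1 / (1 - fps_X) = Abs_fps (\<lambda>_. 1 :: rat)"
    using one_minus_const_fps_X_neg_power'[of 1 "1 :: rat"] by (simp add: fps_divide_unit)
  have "coeff (coefficientwise (series_of x) p) m = coeff (binomial_of x p) m" for p m
    using k nth_cdes_series[of k n p]
    by (auto simp: coeff_coefficientwise coeff_binomial_of x series_of_def cdes_series_def hfps_inverse
        one zero_hfps.rep_eq)
  then show ?thesis by (simp add: fun_eq_iff poly_eq_iff)
qed

lemma coefficientwise_series_cyc: "C \<in> cperms \<Longrightarrow>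
  coefficientwise (series_of (clen C, cdes C)) = binomial_of (clen C, cdes C)"
  using image_cdes_index by (intro coefficientwise_series) blast

interpretation hadamard: cyc_realization cdes hadamard_algebra series_of
proof
  show "cyc_statistic cdes" by (rule cyc_statistic_cdes)
  show "rat_algebra hadamard_algebra" by (rule rat_algebra_hadamard)
  show "qcarrier hadamard_algebra = UNIV" by (simp add: hadamard_algebra_def)
  have "(0, cdes (cyc [])) \<in> cdes_index" by (simp add: cdes_cyc cdes_lin_def cdes_index_def)
  then show "series_of (0, cdes (cyc [])) = qone hadamard_algebra"
    by (simp add: hadamard_algebra_def coefficientwise_series coefficientwise_simps binomial_of_def
        fun_eq_iff flip: coefficientwise_inject)
next
  fix \<pi> \<sigma> :: "nat list" assume lp: "lperm \<pi>" "lperm \<sigma>" "ldisjoint \<pi> \<sigma>"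
  have "coefficientwise (series_of (length \<pi>, cdes (cyc \<pi>)) * series_of (length \<sigma>, cdes (cyc \<sigma>)))
      = coefficientwise (\<Sum>C\<in>cSh (cyc \<pi>) (cyc \<sigma>). series_of (clen C, cdes C))"
    using lp binomial_of_mult[OF lp] cSh_D(1)[of _ \<pi> \<sigma>]
    by (simp add: coefficientwise_simps coefficientwise_sum coefficientwise_series_cyc coefficientwise_series
      cdes_lin_index cdes_cyc)
  then show "qmult hadamard_algebra (series_of (length \<pi>, cdes (cyc \<pi>)))
      (series_of (length \<sigma>, cdes (cyc \<sigma>))) = (\<Sum>C\<in>cSh (cyc \<pi>) (cyc \<sigma>). series_of (clen C, cdes C))"
    by (simp add: hadamard_algebra_def coefficientwise_inject)
next
  fix X :: "(nat \<times> nat) set" and a x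
  assume X: "finite X" "X \<subseteq> (\<lambda>C. (clen C, cdes C)) ` cperms" and x: "x \<in> X"
    and zero: "(\<Sum>x\<in>X. qscale hadamard_algebra (a x) (series_of x)) = 0"
  have X': "X \<subseteq> cdes_index" using X(2) by (simp add: image_cdes_index)
  have "coefficientwise (\<Sum>x\<in>X. hadamard_scale (a x) (series_of x)) = 0"
    using zero by (simp add: hadamard_algebra_def coefficientwise_simps)
  moreover have "coefficientwise (\<Sum>x\<in>X. hadamard_scale (a x) (series_of x)) =
      (\<Sum>x\<in>X. (\<lambda>p. smult (a x) (binomial_of x p)))"
    unfolding coefficientwise_sum
    by (rule sum.cong) (use X' in \<open>auto simp: coefficientwise_simps coefficientwise_series\<close>)
  ultimately have "(\<Sum>x\<in>X. (\<lambda>p. smult (a x) (binomial_of x p))) = 0" by simp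
  then show "a x = 0" using binomial_of_independent[OF X(1) X' x] by blast
qed

section \<open>Dimensions of the homogeneous components\<close>

lemma dim_cyc_homog_cdes:
  assumes "n \<ge> 2"
  shows "cyc.dim (cyc_homog cdes n) = n - 1"
proof -
  let ?B = "{bas cdes (cyc \<pi>) | \<pi>. lperm \<pi> \<and> length \<pi> = n}"
  have "\<exists>\<pi>. lperm \<pi> \<and> length \<pi> = n \<and> cdes_lin \<pi> = k" if "k \<in> {1..<n}" for k
    using that ex_lperm_cdes[of k n] by auto
  then obtain \<rho> where \<rho>: "\<And>k. k \<in> {1..<n} \<Longrightarrow> lperm (\<rho> k) \<and> length (\<rho> k) = n \<and> cdes_lin (\<rho> k) = k"
    by metis
  let ?c = "\<lambda>k. cls cdes (cyc (\<rho> k))"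
  have inj: "inj_on ?c {1..<n}"
    using \<rho> by (auto simp: inj_on_def cls_eq_iff cyc_in_cperms cdes_cyc)
  have "bas cdes (cyc \<pi>) = bas cdes (cyc (\<rho> (cdes_lin \<pi>))) \<and> cdes_lin \<pi> \<in> {1..<n}"
    if "lperm \<pi>" "length \<pi> = n" for \<pi>
  proof
    show *: "cdes_lin \<pi> \<in> {1..<n}" using cdes_lin_index[OF that(1)] that assms
      by (auto simp: cdes_index_def)
    show "bas cdes (cyc \<pi>) = bas cdes (cyc (\<rho> (cdes_lin \<pi>)))"
      using \<rho>[OF *] that cls_eq_iff[of "cyc \<pi>" "cyc (\<rho> (cdes_lin \<pi>))" cdes]
      by (simp add: bas_def cyc_in_cperms cdes_cyc clen_cyc)
  qed
  note \<pi> = this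
  have B: "?B = (\<lambda>c. Poly_Mapping.single c (1::rat)) ` ?c ` {1..<n}"
  proof (intro equalityI subsetI)
    fix u assume "u \<in> ?B"
    then show "u \<in> (\<lambda>c. Poly_Mapping.single c 1) ` ?c ` {1..<n}"
      using \<pi> unfolding bas_def by blast
  next
    fix u assume "u \<in> (\<lambda>c. Poly_Mapping.single c (1::rat)) ` ?c ` {1..<n}"
    then show "u \<in> ?B" using \<rho> unfolding bas_def by blast
  qed
  have single_inj: "inj_on (\<lambda>c. Poly_Mapping.single c (1::rat)) Y" for Y
    by (rule inj_onI) (metis lookup_single_eq lookup_single_not_eq zero_neq_one)
  have "cyc.independent ?B"
  proof (rule cyc.independent_if_scalars_zero)
    show "finite ?B" unfolding B by simp
    fix f x assume f: "(\<Sum>x\<in>?B. cyc_scale (f x) x) = 0" and "x \<in> ?B"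
    then obtain c where c: "c \<in> ?c ` {1..<n}" "x = Poly_Mapping.single c 1" unfolding B by blast
    have "0 = Poly_Mapping.lookup (\<Sum>x\<in>?B. cyc_scale (f x) x) c" by (simp add: f)
    also have "\<dots> = (\<Sum>d\<in>?c ` {1..<n}. if d = c then f x else 0)"
      unfolding B sum.reindex[OF single_inj] lookup_sum
      by (intro sum.cong) (auto simp: c(2) lookup_single when_def)
    also have "\<dots> = f x" using c(1) by (simp add: sum.delta)
    finally show "f x = 0" by simp
  qed
  then have "cyc.dim (cyc.span ?B) = card ?B" by (rule cyc.dim_span_eq_card_independent)
  also have "card ?B = n - 1" unfolding B using inj by (simp add: card_image single_inj)
  finally show ?thesis by (simp add: cyc_homog_def cyc_algebra_def)
qed

section \<open>The algebra of cyclic descent numbers\<close>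

lemma image_cdes_index_generators:
  assumes "\<And>n k. n \<ge> 2 \<Longrightarrow> f (n, k) = g n k"
  shows "f ` cdes_index = {f (0, 0), f (1, 0)} \<union> {g n k | n k. n \<ge> 2 \<and> 1 \<le> k \<and> k \<le> n - 1}"
proof -
  have "f ` {(n, k) | n k. n \<ge> 2 \<and> 1 \<le> k \<and> k \<le> n - 1} =
      {g n k | n k. n \<ge> 2 \<and> 1 \<le> k \<and> k \<le> n - 1}"
  proof (intro equalityI subsetI)
    fix y assume "y \<in> f ` {(n, k) | n k. n \<ge> 2 \<and> 1 \<le> k \<and> k \<le> n - 1}"
    then obtain n k where "y = f (n, k)" "n \<ge> 2" "1 \<le> k" "k \<le> n - 1" by blast
    with assms[of n k] show "y \<in> {g n k | n k. n \<ge> 2 \<and> 1 \<le> k \<and> k \<le> n - 1}" by blast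
  next
    fix y assume "y \<in> {g n k | n k. n \<ge> 2 \<and> 1 \<le> k \<and> k \<le> n - 1}"
    then obtain n k where "y = g n k" and nk: "n \<ge> 2" "1 \<le> k" "k \<le> n - 1" by blast
    then have "y = f (n, k)" using assms[of n k] by simp
    with nk show "y \<in> f ` {(n, k) | n k. n \<ge> 2 \<and> 1 \<le> k \<and> k \<le> n - 1}" by blast
  qed
  then show ?thesis by (simp only: cdes_index_def image_Un image_insert image_empty)
qed

lemma series_generators:
  "series_of ` (\<lambda>C. (clen C, cdes C)) ` cperms =
    {monom (hfps (1 / (1 - fps_X))) 0, monom (hfps (fps_X / (1 - fps_X) ^ 2)) 1}
    \<union> {cdes_series n k | n k. n \<ge> 2 \<and> 1 \<le> k \<and> k \<le> n - 1}"
  unfolding image_cdes_index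
  by (subst image_cdes_index_generators[where g = cdes_series])
    (simp_all add: series_of_def cdes_series_def numeral_2_eq_2)

lemma binomial_generators:
  "binomial_of ` (\<lambda>C. (clen C, cdes C)) ` cperms =
    {\<lambda>p. 1, \<lambda>p. monom (of_nat p) 1}
    \<union> {cdes_binomial n k | n k. n \<ge> 2 \<and> 1 \<le> k \<and> k \<le> n - 1}"
  unfolding image_cdes_index
  by (subst image_cdes_index_generators[where g = cdes_binomial])
    (simp_all add: binomial_of_def cdes_binomial_def)

theorem theorem4p10:
  shows
    "cyc_shuffle_compatible cdes
   \<and> (let S = qspan hadamard_algebra
               ({monom (hfps (1 / (1 - fps_X))) 0, monom (hfps (fps_X / (1 - fps_X) ^ 2)) 1}
                \<union> {cdes_series n k | n k. n \<ge> 2 \<and> 1 \<le> k \<and> k \<le> n - 1})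
      in rat_subalgebra S hadamard_algebra
       \<and> (\<exists>\<phi>. rat_algebra_iso \<phi> (cyc_algebra cdes) (hadamard_algebra\<lparr>qcarrier := S\<rparr>)
            \<and> (\<forall>\<pi>. lperm \<pi> \<longrightarrow> \<phi> (bas cdes (cyc \<pi>)) =
                 (if length \<pi> \<ge> 1 then cdes_series (length \<pi>) (cdes (cyc \<pi>))
                  else monom (hfps (1 / (1 - fps_X))) 0))))
   \<and> (let S = qspan poly_fun_algebra
               ({\<lambda>p. 1, \<lambda>p. monom (of_nat p) 1}
                \<union> {cdes_binomial n k | n k. n \<ge> 2 \<and> 1 \<le> k \<and> k \<le> n - 1})
      in rat_subalgebra S poly_fun_algebra
       \<and> (\<exists>\<phi>. rat_algebra_iso \<phi> (cyc_algebra cdes) (poly_fun_algebra\<lparr>qcarrier := S\<rparr>)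
            \<and> (\<forall>\<pi>. lperm \<pi> \<longrightarrow> \<phi> (bas cdes (cyc \<pi>)) =
                 (if length \<pi> \<ge> 1 then cdes_binomial (length \<pi>) (cdes (cyc \<pi>))
                  else (\<lambda>p. 1)))))
   \<and> (\<forall>n\<ge>2. vector_space.dim (qscale (cyc_algebra cdes)) (cyc_homog cdes n) = n - 1)"
  unfolding Let_def series_generators[symmetric] binomial_generators[symmetric]
proof (intro conjI exI allI impI)
  show "cyc_shuffle_compatible cdes" by (rule poly_fun.shuffle_compatible)
  show "rat_subalgebra (qspan hadamard_algebra (series_of ` (\<lambda>C. (clen C, cdes C)) ` cperms)) hadamard_algebra"
    by (rule hadamard.subalgebra_span)
  show "rat_algebra_iso hadamard.realize (cyc_algebra cdes)
      (hadamard_algebra\<lparr>qcarrier := qspan hadamard_algebra (series_of ` (\<lambda>C. (clen C, cdes C)) ` cperms)\<rparr>)"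
    by (rule hadamard.iso_span)
  show "rat_subalgebra (qspan poly_fun_algebra (binomial_of ` (\<lambda>C. (clen C, cdes C)) ` cperms)) poly_fun_algebra"
    by (rule poly_fun.subalgebra_span)
  show "rat_algebra_iso poly_fun.realize (cyc_algebra cdes)
      (poly_fun_algebra\<lparr>qcarrier := qspan poly_fun_algebra (binomial_of ` (\<lambda>C. (clen C, cdes C)) ` cperms)\<rparr>)"
    by (rule poly_fun.iso_span)
next
  fix \<pi> :: "nat list" assume "lperm \<pi>"
  then have \<pi>: "cyc \<pi> \<in> cperms" by (rule cyc_in_cperms)
  show "hadamard.realize (bas cdes (cyc \<pi>)) = (if length \<pi> \<ge> 1
      then cdes_series (length \<pi>) (cdes (cyc \<pi>)) else monom (hfps (1 / (1 - fps_X))) 0)"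
    "poly_fun.realize (bas cdes (cyc \<pi>)) = (if length \<pi> \<ge> 1
      then cdes_binomial (length \<pi>) (cdes (cyc \<pi>)) else (\<lambda>p. 1))"
    unfolding hadamard.realize_bas[OF \<pi>] poly_fun.realize_bas[OF \<pi>]
    by (auto simp: clen_cyc series_of_def binomial_of_def Suc_le_eq)
next
  fix n :: nat assume "n \<ge> 2"
  then show "vector_space.dim (qscale (cyc_algebra cdes)) (cyc_homog cdes n) = n - 1"
    using dim_cyc_homog_cdes by (simp add: cyc_algebra_def)
qed

end
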